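(* Let $Q:\mathbb{T}^n\to[0,+\infty)$ be real analytic with zero set $\mathscr{Z}=\{\Phi\in\mathbb{T}^n:Q(\Phi)=0\}$ nonempty and finite, let $\Phi_0\in\mathbb{T}^n$, and let $\Phi\in\mathscr{A}$ be a global minimizer over $\mathscr{A}$ of $$K(\Phi)=\int_0^\infty\tfrac12\|\dot\Phi\|^2+Q(\Phi)\,dt .$$ Then: (1) there exists $\overline\Phi\in\operatorname{argmin}(Q)$ such that, as $t\to+\infty$, $$\Phi(t)\to\overline\Phi,\qquad\dot\Phi(t)\to0,\qquad|Q(\Phi(t))|\to0;$$ (2) the Euler-Lagrange equations hold together with a final condition: $$\begin{cases}\ddot\Phi=\nabla Q(\Phi)& t\in(0,+\infty)\\ \Phi(0)=\Phi_0,\quad\dot\Phi(T)\to0\ \text{ as }T\to+\infty.\end{cases}$$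
   Context: $\mathbb{T}=\mathbb{R}/2\pi\mathbb{Z}$. $H^1_{loc}([0,+\infty);\mathbb{T}^n)$ is the set of maps $\Phi:[0,+\infty)\to\mathbb{T}^n$ belonging to $H^1((0,T);\mathbb{T}^n)$ for every $T>0$ (continuous, weakly differentiable with $\dot\Phi\in L^2((0,T);\mathbb{R}^n)$). The set of admissible trajectories is $$\mathscr{A}=\left\{\Phi\in H^1_{loc}([0,+\infty);\mathbb{T}^n)\ :\ \Phi(0)=\Phi_0,\ \tfrac12\|\dot\Phi\|^2+Q(\Phi)\in L^1(0,+\infty)\right\}.$$ *)

theory Defs
  imports "HOL-Analysis.Analysis"
begin

definition circle_rel :: "real \<Rightarrow> real \<Rightarrow> bool" where
  "circle_rel x y \<longleftrightarrow> (\<exists>k::int. x - y = 2 * pi * of_int k)"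

lemma equivp_circle_rel: "equivp circle_rel"
proof (rule equivpI)
  show "reflp circle_rel"
    unfolding reflp_def circle_rel_def by (auto intro: exI[of _ 0])
  show "symp circle_rel"
    unfolding symp_def circle_rel_def
  proof (intro allI impI)
    fix x y :: real
    assume "\<exists>k::int. x - y = 2 * pi * of_int k"
    then obtain k :: int where "x - y = 2 * pi * of_int k" ..
    then have "y - x = 2 * pi * of_int (- k)" by simp
    then show "\<exists>k::int. y - x = 2 * pi * of_int k" ..
  qed
  show "transp circle_rel"
    unfolding transp_def circle_rel_def
  proof (intro allI impI)
    fix x y z :: real
    assume "\<exists>k::int. x - y = 2 * pi * of_int k" "\<exists>k::int. y - z = 2 * pi * of_int k"
    then obtain k l :: int where "x - y = 2 * pi * of_int k" "y - z = 2 * pi * of_int l"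
      by auto
    then have "x - z = 2 * pi * of_int (k + l)" by (simp add: algebra_simps)
    then show "\<exists>k::int. x - z = 2 * pi * of_int k" ..
  qed
qed

quotient_type circle = real / circle_rel
  by (rule equivp_circle_rel)

text \<open>The circle carries the quotient topology. The torus is the type \<open>circle ^ 'n\<close>,
  whose library topology is the product topology.\<close>

instantiation circle :: topological_space
begin

definition open_circle :: "circle set \<Rightarrow> bool" where
  "open_circle U \<longleftrightarrow> open (abs_circle -` U)"

instance
proof
  show "open (UNIV :: circle set)"
    by (simp add: open_circle_def)
  show "open (S \<inter> T)" if "open S" "open T" for S T :: "circle set"
    using that by (simp add: open_circle_def open_Int)
  show "open (\<Union> \<U>)" if "\<forall>S\<in>\<U>. open S" for \<U> :: "circle set set"
    using that by (auto simp: open_circle_def vimage_Union)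
qed

end

definition torus_proj :: "real ^ 'n \<Rightarrow> circle ^ 'n" where
  "torus_proj x = (\<chi> i. abs_circle (x $ i))"

text \<open>Near every point the function is the sum of a power series in several variables; the
  function \<open>\<alpha>\<close> is a multi-index.\<close>

definition real_analytic :: "(real ^ 'n \<Rightarrow> real) \<Rightarrow> bool" where
  "real_analytic f \<longleftrightarrow>
     (\<forall>x. \<exists>r>0. \<exists>c :: ('n \<Rightarrow> nat) \<Rightarrow> real. \<forall>y\<in>ball x r.
        ((\<lambda>\<alpha>. c \<alpha> * (\<Prod>i\<in>UNIV. (y $ i - x $ i) ^ \<alpha> i)) has_sum f y) UNIV)"

text \<open>The covering map \<open>torus_proj\<close> provides the charts of the torus and identifies all tangent
  spaces with \<open>real ^ 'n\<close>.\<close>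

definition torus_real_analytic :: "(circle ^ 'n \<Rightarrow> real) \<Rightarrow> bool" where
  "torus_real_analytic Q \<longleftrightarrow> real_analytic (Q \<circ> torus_proj)"

definition torus_gradient :: "(circle ^ 'n \<Rightarrow> real) \<Rightarrow> circle ^ 'n \<Rightarrow> real ^ 'n" where
  "torus_gradient Q p = (THE g. \<forall>x. torus_proj x = p \<longrightarrow> GDERIV (Q \<circ> torus_proj) x :> g)"

definition has_torus_derivative :: "(real \<Rightarrow> circle ^ 'n) \<Rightarrow> real ^ 'n \<Rightarrow> real \<Rightarrow> bool" where
  "has_torus_derivative \<Phi> v t \<longleftrightarrow>
     (\<exists>\<phi>. (\<forall>\<^sub>F s in nhds t. \<Phi> s = torus_proj (\<phi> s)) \<and> (\<phi> has_vector_derivative v) (at t))"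

text \<open>Weak derivatives are tested against \<open>C\<^sup>1\<close> functions of compact support, as is usual for
  Sobolev spaces on an interval.\<close>

definition test_function_on :: "real set \<Rightarrow> (real \<Rightarrow> real) \<Rightarrow> bool" where
  "test_function_on S \<eta> \<longleftrightarrow>
     \<eta> C1_differentiable_on UNIV \<and> (\<exists>C. compact C \<and> C \<subseteq> S \<and> (\<forall>t. t \<notin> C \<longrightarrow> \<eta> t = 0))"

definition locally_integrable_on :: "(real \<Rightarrow> 'a::euclidean_space) \<Rightarrow> real set \<Rightarrow> bool" where
  "locally_integrable_on f S \<longleftrightarrow>
     (\<forall>C. compact C \<and> C \<subseteq> S \<longrightarrow> f absolutely_integrable_on C)"

definition has_weak_derivative_on ::
  "(real \<Rightarrow> 'a::euclidean_space) \<Rightarrow> (real \<Rightarrow> 'a) \<Rightarrow> real set \<Rightarrow> bool" where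
  "has_weak_derivative_on f g S \<longleftrightarrow>
     locally_integrable_on f S \<and> locally_integrable_on g S \<and>
     (\<forall>\<eta>. test_function_on S \<eta> \<longrightarrow>
        (LINT t:S|lebesgue. deriv \<eta> t *\<^sub>R f t) = - (LINT t:S|lebesgue. \<eta> t *\<^sub>R g t))"

text \<open>A continuous curve in the torus has a continuous lift, unique up to a constant in
  \<open>2 \<pi> \<int>\<^sup>n\<close>; the weak derivative of the curve is that of the lift.\<close>

definition has_torus_weak_derivative :: "(real \<Rightarrow> circle ^ 'n) \<Rightarrow> (real \<Rightarrow> real ^ 'n) \<Rightarrow> bool" where
  "has_torus_weak_derivative \<Phi> v \<longleftrightarrow>
     (\<exists>\<phi>. continuous_on {0..} \<phi> \<and> (\<forall>t\<ge>0. \<Phi> t = torus_proj (\<phi> t)) \<and>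
          has_weak_derivative_on \<phi> v {0<..})"

text \<open>The weak derivative is determined almost everywhere; we fix a representative.\<close>

definition torus_weak_derivative :: "(real \<Rightarrow> circle ^ 'n) \<Rightarrow> real \<Rightarrow> real ^ 'n" where
  "torus_weak_derivative \<Phi> = (SOME v. has_torus_weak_derivative \<Phi> v)"

definition square_integrable_on :: "(real \<Rightarrow> 'a::euclidean_space) \<Rightarrow> real set \<Rightarrow> bool" where
  "square_integrable_on f S \<longleftrightarrow>
     set_borel_measurable lebesgue S f \<and> set_integrable lebesgue S (\<lambda>t. (norm (f t))\<^sup>2)"

text \<open>Curves on \<open>[0, \<infinity>)\<close> are functions on all reals; their values at negative times are
  irrelevant throughout.\<close>

definition H1_loc :: "(real \<Rightarrow> circle ^ 'n) set" where
  "H1_loc = {\<Phi>. continuous_on {0..} \<Phi> \<and> (\<exists>v. has_torus_weak_derivative \<Phi> v) \<and>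
     (\<forall>T>0. square_integrable_on (torus_weak_derivative \<Phi>) {0<..<T})}"

definition lagrangian :: "(circle ^ 'n \<Rightarrow> real) \<Rightarrow> (real \<Rightarrow> circle ^ 'n) \<Rightarrow> real \<Rightarrow> real" where
  "lagrangian Q \<Phi> t = 1/2 * (norm (torus_weak_derivative \<Phi> t))\<^sup>2 + Q (\<Phi> t)"

definition admissible ::
  "(circle ^ 'n \<Rightarrow> real) \<Rightarrow> circle ^ 'n \<Rightarrow> (real \<Rightarrow> circle ^ 'n) set" where
  "admissible Q \<Phi>\<^sub>0 =
     {\<Phi> \<in> H1_loc. \<Phi> 0 = \<Phi>\<^sub>0 \<and> set_integrable lebesgue {0<..} (lagrangian Q \<Phi>)}"

definition action :: "(circle ^ 'n \<Rightarrow> real) \<Rightarrow> (real \<Rightarrow> circle ^ 'n) \<Rightarrow> real" where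
  "action Q \<Phi> = (LINT t:{0<..}|lebesgue. lagrangian Q \<Phi> t)"

end

theory Submission imports Defs begin

text \<open>Lift everything to \<open>f = Q \<circ> torus_proj\<close> on \<open>\<real>\<^sup>n\<close>, which is \<open>C\<^sup>1\<close> by termwise differentiation of its
  power series. Comparing the minimizer with the variations \<open>\<phi> + \<epsilon> \<eta> e\<close> of its lift \<open>\<phi>\<close> shows that
  the weak derivative of \<open>\<phi>\<close> itself has the continuous weak derivative \<open>\<nabla>f(\<phi>)\<close>; by the du Bois-Reymond
  lemma \<open>\<phi>\<close> is \<open>C\<^sup>2\<close> and the Euler-Lagrange equation holds classically. Energy is then conserved, so
  the Lagrangian is a Lipschitz, nonnegative, integrable function of time and tends to 0; hence both
  the velocity and \<open>f(\<phi>)\<close> do. As the zeros of \<open>f\<close> are uniformly separated, the connected tail of the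
  trajectory stays near a single zero and converges to it.\<close>

section \<open>Power series in several variables\<close>

text \<open>The action sees a curve only through a representative of its weak derivative picked by
  choice, and the torus is given with a topology alone. Estimates are therefore made for a lift,
  where periodicity and the closed cube of side 2 pi stand in for compactness of the torus;
  comparing two curves rests on two uniqueness facts: lifts differ by a constant, and weak
  derivatives agree almost everywhere. The variations have compact support in (0, \<infinity>): they
  keep the initial point, and they change the action only by integrals over a compact interval, so
  integrability at infinity is never at stake. The kinetic term is quadratic, hence its expansion in
  \<epsilon> is exact and only the potential is differentiated under the integral sign. Regularity
  takes two rounds: the weak derivative first gets a C^1 representative almost everywhere, and only
  then does the lift, being continuous, have it as classical derivative at every positive
  time.\<close>

lemma GDERIV_unique:
  assumes "GDERIV f x :> a" and "GDERIV f x :> b"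
  shows "a = b"
proof -
  have "(\<lambda>h. inner h a) = (\<lambda>h. inner h b)"
    using assms unfolding gderiv_def by (rule has_derivative_unique)
  then show ?thesis
    by (metis inner_commute vector_eq_rdot)
qed

text \<open>The exponent \<open>\<alpha> i - 1\<close> is truncated subtraction; for
  \<open>\<alpha> i = 0\<close> the factor \<open>real (\<alpha> i)\<close> makes the whole
  component vanish, as it should.\<close>

definition monomial_gradient :: "('n \<Rightarrow> nat) \<Rightarrow> real ^ 'n \<Rightarrow> real ^ 'n" where
  "monomial_gradient \<alpha> u =
     (\<chi> i. real (\<alpha> i) * u $ i ^ (\<alpha> i - 1) * (\<Prod>j\<in>UNIV - {i}. u $ j ^ \<alpha> j))"

lemma GDERIV_monomial:
  "GDERIV (\<lambda>y. \<Prod>i\<in>UNIV. (y $ i - x $ i) ^ \<alpha> i) y :> monomial_gradient \<alpha> (y - x)"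
proof -
  have "((\<lambda>y. (y $ i - x $ i) ^ \<alpha> i) has_derivative
          (\<lambda>h. real (\<alpha> i) * h $ i * (y $ i - x $ i) ^ (\<alpha> i - 1))) (at y)" for i
    by (auto intro!: derivative_eq_intros bounded_linear_imp_has_derivative bounded_linear_vec_nth)
  from has_derivative_prod[of UNIV, OF this]
  show ?thesis
    unfolding gderiv_def monomial_gradient_def inner_vec_def
    by (simp add: mult_ac)
qed

lemma continuous_on_monomial_gradient [continuous_intros]:
  assumes "continuous_on S f"
  shows "continuous_on S (\<lambda>y. monomial_gradient \<alpha> (f y))"
  unfolding monomial_gradient_def by (intro continuous_intros assms)

text \<open>Halving the polyradius gains a factor \<open>2\<^sup>-\<^sup>k\<close>, which absorbs the exponent \<open>k\<close> produced by
  differentiation.\<close>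

lemma norm_monomial_gradient_le:
  fixes u :: "real ^ 'n"
  assumes "0 < \<rho>" and u: "\<And>i. \<bar>u $ i\<bar> \<le> \<rho> / 2"
  shows "norm (monomial_gradient \<alpha> u) \<le> CARD('n) * (2 / \<rho>) * (\<Prod>i\<in>UNIV. \<rho> ^ \<alpha> i)"
proof -
  have "\<bar>monomial_gradient \<alpha> u $ i\<bar> \<le> (2 / \<rho>) * (\<Prod>i\<in>UNIV. \<rho> ^ \<alpha> i)" for i
  proof -
    have 1: "real (\<alpha> i) * \<bar>u $ i\<bar> ^ (\<alpha> i - 1) \<le> (2 / \<rho>) * \<rho> ^ \<alpha> i"
    proof (cases "\<alpha> i")
      case 0
      then show ?thesis using assms by simp
    next
      case (Suc k)
      have "real (Suc k) * \<bar>u $ i\<bar> ^ k \<le> real (Suc k) * (\<rho> / 2) ^ k"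
        by (intro mult_left_mono power_mono u) auto
      also have "\<dots> \<le> 2 ^ Suc k * (\<rho> / 2) ^ k"
        using of_nat_less_two_power[of "Suc k", where ?'a = real] \<open>0 < \<rho>\<close>
        by (intro mult_right_mono) simp_all
      \<comment> \<open>Differentiation costs one power of \<rho>: 2^(k+1) (\<rho>/2)^k = 2
        \<rho>^k, whence the factor 2 / \<rho>.\<close>
      also have "\<dots> = (2 / \<rho>) * \<rho> ^ Suc k"
        using \<open>0 < \<rho>\<close> by (simp add: power_divide)
      finally show ?thesis using Suc by simp
    qed
    have 2: "(\<Prod>j\<in>UNIV - {i}. \<bar>u $ j\<bar> ^ \<alpha> j) \<le> (\<Prod>j\<in>UNIV - {i}. \<rho> ^ \<alpha> j)"
      using u \<open>0 < \<rho>\<close> 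
      by (intro prod_mono conjI power_mono) (auto intro: order.trans[OF u])
    have "\<bar>monomial_gradient \<alpha> u $ i\<bar>
            = real (\<alpha> i) * \<bar>u $ i\<bar> ^ (\<alpha> i - 1) * (\<Prod>j\<in>UNIV - {i}. \<bar>u $ j\<bar> ^ \<alpha> j)"
      unfolding monomial_gradient_def by (simp add: abs_mult abs_prod power_abs)
    also have "\<dots> \<le> (2 / \<rho>) * \<rho> ^ \<alpha> i * (\<Prod>j\<in>UNIV - {i}. \<rho> ^ \<alpha> j)"
      using \<open>0 < \<rho>\<close> by (intro mult_mono 1 2) (auto intro: prod_nonneg)
    also have "\<dots> = (2 / \<rho>) * (\<Prod>i\<in>UNIV. \<rho> ^ \<alpha> i)"
      by (simp add: prod.remove[of UNIV i])
    finally show ?thesis .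
  qed
  then have "(\<Sum>i\<in>UNIV. \<bar>monomial_gradient \<alpha> u $ i\<bar>)
      \<le> CARD('n) * ((2 / \<rho>) * (\<Prod>i\<in>UNIV. \<rho> ^ \<alpha> i))"
    by (intro sum_bounded_above) auto
  then show ?thesis
    using norm_le_l1_cart[of "monomial_gradient \<alpha> u"] by simp
qed

text \<open>Makes \<open>from_nat_into\<close> a bijection from all of \<open>nat\<close> onto the
  multi-indices; the constant ones are already infinitely many.\<close>

lemma infinite_UNIV_multi_index: "infinite (UNIV :: ('n::finite \<Rightarrow> nat) set)"
proof -
  have "inj (\<lambda>k::nat. (\<lambda>_::'n. k))"
    by (auto intro!: injI dest: fun_cong)
  then show ?thesis
    using finite_subset[OF subset_UNIV] range_inj_infinite by blast
qed

text \<open>Along an enumeration of the multi-indices the sum becomes an ordinary series. Absolute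
  convergence at a single point, a corner of a cube inside the ball, controls the coefficients; on a
  smaller ball this dominates the differentiated series, so the Weierstrass test permits termwise
  differentiation.\<close>

lemma power_series_C1:
  fixes f :: "real ^ 'n \<Rightarrow> real" and c :: "('n \<Rightarrow> nat) \<Rightarrow> real"
  assumes "0 < r"
    and sum: "\<And>y. y \<in> ball x r \<Longrightarrow>
      ((\<lambda>\<alpha>. c \<alpha> * (\<Prod>i\<in>UNIV. (y $ i - x $ i) ^ \<alpha> i)) has_sum f y) UNIV"
  shows "\<exists>d>0. \<exists>g. continuous_on (ball x d) g \<and> (\<forall>y\<in>ball x d. GDERIV f y :> g y)"
proof -
  \<comment> \<open>The vector with all n = \<open>CARD('n)\<close> entries equal to \<rho> has norm
    at most n \<rho> = r / 2, so it stays inside the ball of convergence when added to x.\<close>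
  define \<rho> where "\<rho> = r / (2 * CARD('n))"
  have "0 < \<rho>" and "\<rho> \<le> r / 2"
    unfolding \<rho>_def using \<open>0 < r\<close> by (auto simp: field_simps Suc_leI)
  define e :: "nat \<Rightarrow> 'n \<Rightarrow> nat" where "e = from_nat_into UNIV"
  have e: "bij_betw e UNIV UNIV"
    unfolding e_def by (intro bij_betw_from_nat_into infinite_UNIV_multi_index) auto
  have sums: "(\<lambda>k. c (e k) * (\<Prod>i\<in>UNIV. (y $ i - x $ i) ^ e k i)) sums f y"
    if "y \<in> ball x r" for y
    by (rule has_sum_imp_sums[OF iffD2[OF has_sum_reindex_bij_betw[OF e] sum[OF that]]])
  define A where "A = (\<lambda>\<alpha>. \<bar>c \<alpha>\<bar> * (\<Prod>i\<in>UNIV. \<rho> ^ \<alpha> i))"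
  have "summable (\<lambda>k. A (e k))"
  proof -
    have "norm (\<chi> i::'n. \<rho>) \<le> CARD('n) * \<rho>"
      using norm_le_l1_cart[of "\<chi> i::'n. \<rho>"] \<open>0 < \<rho>\<close> by simp
    then have "norm (\<chi> i::'n. \<rho>) < r"
      unfolding \<rho>_def using \<open>0 < r\<close> by simp
    then have "x + (\<chi> i. \<rho>) \<in> ball x r"
      by (simp add: dist_norm)
    from sum[OF this] have "(\<lambda>\<alpha>. c \<alpha> * (\<Prod>i\<in>UNIV. \<rho> ^ \<alpha> i)) summable_on UNIV"
      by (auto simp: summable_on_def)
    then have "(\<lambda>\<alpha>. norm (c \<alpha> * (\<Prod>i\<in>UNIV. \<rho> ^ \<alpha> i))) summable_on UNIV"
      by (rule iffD1[OF summable_on_iff_abs_summable_on_real])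
    then have "A summable_on UNIV"
      unfolding A_def using \<open>0 < \<rho>\<close> by (simp add: abs_mult abs_prod prod_nonneg)
    then show ?thesis
      by (rule summable_on_imp_summable[OF iffD2[OF summable_on_reindex_bij_betw[OF e]]])
  qed
  then have summable: "summable (\<lambda>k. CARD('n) * (2 / \<rho>) * A (e k))"
    by (rule summable_mult)
  let ?B = "ball x (\<rho> / 2)"
  let ?G = "\<lambda>k y. c (e k) *\<^sub>R monomial_gradient (e k) (y - x)"
  have bound: "norm (?G k y) \<le> CARD('n) * (2 / \<rho>) * A (e k)" if "y \<in> ?B" for k y
  proof -
    have "\<bar>(y - x) $ i\<bar> \<le> \<rho> / 2" for i
      using that component_le_norm_cart[of "y - x" i] by (simp add: dist_norm norm_minus_commute)
    from mult_left_mono[OF norm_monomial_gradient_le[OF \<open>0 < \<rho>\<close> this], of "\<bar>c (e k)\<bar>" "e k"]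
    show ?thesis
      unfolding A_def by (simp add: mult_ac)
  qed
  define g where "g = (\<lambda>y. \<Sum>k. ?G k y)"
  have lim: "uniform_limit ?B (\<lambda>n y. \<Sum>k<n. ?G k y) g sequentially"
    unfolding g_def by (rule Weierstrass_m_test[OF bound summable])
  have cont: "continuous_on ?B g"
    by (rule uniform_limit_theorem[OF _ lim]) (simp_all add: continuous_intros)
  \<comment> \<open>The theorem on differentiating series returns some sum function; uniqueness of
    sums identifies it with f afterwards.\<close>
  have "\<exists>g'. \<forall>y\<in>?B. (\<lambda>k. c (e k) * (\<Prod>i\<in>UNIV. (y $ i - x $ i) ^ e k i)) sums g' y \<and>
      (g' has_derivative (\<lambda>h. inner h (g y))) (at y within ?B)"
  proof (rule has_derivative_series[where f' = "\<lambda>k y h. inner h (?G k y)"])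
    show "((\<lambda>y. c (e k) * (\<Prod>i\<in>UNIV. (y $ i - x $ i) ^ e k i)) has_derivative
        (\<lambda>h. inner h (?G k y))) (at y within ?B)" for k y
      using has_derivative_mult_right[OF GDERIV_monomial[unfolded gderiv_def], of "c (e k)" x "e k" y]
      by (auto intro: has_derivative_at_withinI)
    show "\<forall>\<^sub>F n in sequentially. \<forall>y\<in>?B. \<forall>h.
        norm ((\<Sum>k<n. inner h (?G k y)) - inner h (g y)) \<le> \<epsilon> * norm h" if "0 < \<epsilon>" for \<epsilon> :: real
      using uniform_limitD[OF lim that]
    proof eventually_elim
      case (elim n)
      show ?case
      proof (intro ballI allI)
        fix y h assume "y \<in> ?B"
        with elim have "norm ((\<Sum>k<n. ?G k y) - g y) \<le> \<epsilon>"
          by (auto simp: dist_norm less_imp_le)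
        then have "norm (inner h ((\<Sum>k<n. ?G k y) - g y)) \<le> norm h * \<epsilon>"
          unfolding real_norm_def
          by (intro order.trans[OF Cauchy_Schwarz_ineq2] mult_left_mono norm_ge_zero)
        then show "norm ((\<Sum>k<n. inner h (?G k y)) - inner h (g y)) \<le> \<epsilon> * norm h"
          by (simp only: inner_diff_right inner_sum_right mult.commute[of _ \<epsilon>])
      qed
    qed
    show "x \<in> ?B" using \<open>0 < \<rho>\<close> by simp
    show "(\<lambda>k. c (e k) * (\<Prod>i\<in>UNIV. (x $ i - x $ i) ^ e k i)) sums f x"
      using \<open>0 < r\<close> by (intro sums) auto
  qed auto
  then obtain g' where g': "\<And>y. y \<in> ?B \<Longrightarrow> (\<lambda>k. c (e k) * (\<Prod>i\<in>UNIV. (y $ i - x $ i) ^ e k i)) sums g' y"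
    "\<And>y. y \<in> ?B \<Longrightarrow> (g' has_derivative (\<lambda>h. inner h (g y))) (at y within ?B)"
    by blast
  have eq: "f y = g' y" if "y \<in> ?B" for y
    using that \<open>\<rho> \<le> r / 2\<close> \<open>0 < r\<close> by (intro sums_unique2[OF sums g'(1)]) auto
  have "GDERIV f y :> g y" if "y \<in> ?B" for y
    unfolding gderiv_def
    using has_derivative_transform[OF that eq g'(2)[OF that]]
    unfolding at_within_open[OF that open_ball] .
  with cont \<open>0 < \<rho>\<close> show ?thesis
    by (intro exI[of _ "\<rho> / 2"]) auto
qed

text \<open>Around each point there is a continuous local gradient. Uniqueness of gradients makes it
  agree with one chosen globally, which is therefore continuous.\<close>

lemma real_analytic_C1:
  assumes "real_analytic f"
  obtains g where "continuous_on UNIV g" and "\<And>x. GDERIV f x :> g x"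
proof -
  have local: "\<exists>d>0. \<exists>g. continuous_on (ball x d) g \<and> (\<forall>y\<in>ball x d. GDERIV f y :> g y)" for x
  proof -
    obtain r c where "0 < r" and "\<And>y. y \<in> ball x r \<Longrightarrow>
        ((\<lambda>\<alpha>. c \<alpha> * (\<Prod>i\<in>UNIV. (y $ i - x $ i) ^ \<alpha> i)) has_sum f y) UNIV"
      using assms unfolding real_analytic_def by blast
    then show ?thesis
      by (rule power_series_C1)
  qed
  then have "\<exists>g. GDERIV f x :> g" for x
    by (meson centre_in_ball)
  then obtain g where g: "\<And>x. GDERIV f x :> g x"
    by metis
  have "isCont g x" for x
  proof -
    obtain d h where d: "0 < d" "continuous_on (ball x d) h" "\<And>y. y \<in> ball x d \<Longrightarrow> GDERIV f y :> h y"
      using local by blast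
    then have "continuous_on (ball x d) g"
      using continuous_on_cong[of "ball x d" "ball x d" h g] GDERIV_unique[OF _ g] by blast
    then show ?thesis
      using d by (simp add: continuous_on_eq_continuous_at)
  qed
  with g show ?thesis
    by (intro that) (auto simp: continuous_on_eq_continuous_at)
qed

section \<open>Weak derivatives on the half-line\<close>

text \<open>Holds because \<open>lebesgue\<close> is complete. It is needed since
  \<open>torus_weak_derivative\<close> of a varied curve is known only up to null sets, yet
  \<open>H1_loc\<close> demands that this representative be measurable.\<close>

lemma borel_measurable_lebesgue_AE:
  fixes f g :: "'a::euclidean_space \<Rightarrow> 'b::topological_space"
  assumes f: "f \<in> borel_measurable lebesgue" and "AE x in lebesgue. f x = g x"
  shows "g \<in> borel_measurable lebesgue"
proof (rule measurableI)
  fix A :: "'b set" assume "A \<in> sets borel"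
  then have 1: "f -` A \<inter> space lebesgue \<in> sets lebesgue"
    using f by (rule measurable_sets[rotated])
  have 2: "AE x in lebesgue. x \<in> f -` A \<inter> space lebesgue \<longleftrightarrow> x \<in> g -` A \<inter> space lebesgue"
    using assms(2) by eventually_elim auto
  show "g -` A \<inter> space lebesgue \<in> sets lebesgue"
    by (rule completion.in_sets_AE[OF 2 1]) simp
qed auto

lemma set_borel_measurable_lebesgue_AE:
  fixes f g :: "'a::euclidean_space \<Rightarrow> 'b::euclidean_space"
  assumes "set_borel_measurable lebesgue S f" and ae: "AE t in lebesgue. t \<in> S \<longrightarrow> f t = g t"
  shows "set_borel_measurable lebesgue S g"
proof -
  have "AE t in lebesgue. indicator S t *\<^sub>R f t = indicator S t *\<^sub>R g t"
    using ae by eventually_elim (auto simp: indicator_def)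
  then show ?thesis
    using assms(1) unfolding set_borel_measurable_def by (rule borel_measurable_lebesgue_AE[rotated])
qed

lemma set_integral_lebesgue_AE:
  fixes f g :: "'a::euclidean_space \<Rightarrow> 'b::euclidean_space"
  assumes f: "set_integrable lebesgue S f" and ae: "AE t in lebesgue. t \<in> S \<longrightarrow> f t = g t"
  shows "set_integrable lebesgue S g" and "(LINT t:S|lebesgue. g t) = (LINT t:S|lebesgue. f t)"
proof -
  have ae': "AE t in lebesgue. indicator S t *\<^sub>R f t = indicator S t *\<^sub>R g t"
    using ae by eventually_elim (auto simp: indicator_def)
  have f_meas: "(\<lambda>t. indicator S t *\<^sub>R f t) \<in> borel_measurable lebesgue"
    using f unfolding set_integrable_def by (rule borel_measurable_integrable)
  have g_meas: "(\<lambda>t. indicator S t *\<^sub>R g t) \<in> borel_measurable lebesgue"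
    using f_meas ae' by (rule borel_measurable_lebesgue_AE)
  show "set_integrable lebesgue S g"
    using f integrable_cong_AE[OF f_meas g_meas ae'] unfolding set_integrable_def by simp
  show "(LINT t:S|lebesgue. g t) = (LINT t:S|lebesgue. f t)"
    using integral_cong_AE[OF f_meas g_meas ae'] unfolding set_lebesgue_integral_def by simp
qed

section \<open>Test functions and integration by parts\<close>

lemma test_function_onI:
  assumes "\<And>t. (\<eta> has_real_derivative \<eta>' t) (at t)" and "continuous_on UNIV \<eta>'"
    and "compact C" and "C \<subseteq> S" and "\<And>t. t \<notin> C \<Longrightarrow> \<eta> t = 0"
  shows "test_function_on S \<eta>"
  using assms unfolding test_function_on_def C1_differentiable_on_def
  by (auto simp: has_real_derivative_iff_has_vector_derivative)

text \<open>The interval strictly encloses the support, so the function and its derivative vanish at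
  both ends as well. Integrals over the half-line thus reduce to \<open>{a..b}\<close> without
  boundary terms.\<close>

lemma test_function_on_halflineE:
  assumes "test_function_on {0<..} \<eta>"
  obtains a b where "0 < a" "a < b"
    "\<And>t. t \<notin> {a<..<b} \<Longrightarrow> \<eta> t = 0" "\<And>t. t \<notin> {a<..<b} \<Longrightarrow> deriv \<eta> t = 0"
    "\<And>t. (\<eta> has_real_derivative deriv \<eta> t) (at t)"
    "continuous_on UNIV \<eta>" "continuous_on UNIV (deriv \<eta>)"
proof -
  obtain C where C: "compact C" "C \<subseteq> {0<..}" "\<And>t. t \<notin> C \<Longrightarrow> \<eta> t = 0"
    using assms unfolding test_function_on_def by blast
  obtain D where D: "\<And>t. (\<eta> has_real_derivative D t) (at t)" "continuous_on UNIV D"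
    using assms unfolding test_function_on_def C1_differentiable_on_def
    by (auto simp: has_real_derivative_iff_has_vector_derivative)
  have [simp]: "deriv \<eta> = D"
    using D(1) by (intro ext DERIV_imp_deriv)
  \<comment> \<open>Off the support the function is 0 on an open set, hence so is its
    derivative.\<close>
  have D_0: "D t = 0" if "t \<notin> C" for t
  proof -
    have "open (- C)" using \<open>compact C\<close> by (simp add: compact_imp_closed open_Compl)
    have "(\<eta> has_real_derivative 0) (at t)"
      by (rule has_field_derivative_transform_within_open[OF DERIV_const[of 0] \<open>open (- C)\<close>])
        (use that C(3) in auto)
    then show ?thesis using D(1) DERIV_unique by blast
  qed
  obtain a b where ab: "0 < a" "a < b" "C \<subseteq> {a<..<b}"
  proof (cases "C = {}")
    case True
    then show ?thesis using that[of 1 2] by simp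
  next
    case False
    obtain m M where "m \<in> C" "M \<in> C" "\<And>t. t \<in> C \<Longrightarrow> m \<le> t" "\<And>t. t \<in> C \<Longrightarrow> t \<le> M"
      using compact_attains_inf[OF C(1) False] compact_attains_sup[OF C(1) False] by blast
    moreover have "0 < m" using C(2) \<open>m \<in> C\<close> by auto
    \<comment> \<open>m / 2 and M + 1 enlarge the support strictly while the left end stays
      positive.\<close>
    ultimately have "C \<subseteq> {m / 2<..<M + 1}" by (force simp: subset_iff)
    moreover have "m \<le> M" using \<open>m \<in> C\<close> \<open>M \<in> C\<close> \<open>\<And>t. t \<in> C \<Longrightarrow> m \<le> t\<close> by blast
    ultimately show ?thesis
      using \<open>0 < m\<close> by (intro that[of "m / 2" "M + 1"]) auto
  qed
  then have notin: "t \<notin> C" if "t \<notin> {a<..<b}" for t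
    using that by blast
  show ?thesis
    using ab(1,2) C(3)[OF notin] D_0[OF notin] D DERIV_continuous_on[OF D(1)]
    by (intro that[of a b]) simp_all
qed

lemma continuous_imp_locally_integrable_on:
  assumes "continuous_on S f"
  shows "locally_integrable_on f S"
  unfolding locally_integrable_on_def set_integrable_def
proof (intro allI impI)
  fix C assume "compact C \<and> C \<subseteq> S"
  then have "integrable lborel (\<lambda>x. indicator C x *\<^sub>R f x)"
    using assms by (intro borel_integrable_compact) (auto intro: continuous_on_subset)
  then show "integrable lebesgue (\<lambda>x. indicator C x *\<^sub>R f x)"
    by (subst integrable_completion) auto
qed

lemma locally_integrable_on_add_scaleR:
  assumes "locally_integrable_on f S" and "locally_integrable_on g S"
  shows "locally_integrable_on (\<lambda>t. f t + c *\<^sub>R g t) S"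
  using assms unfolding locally_integrable_on_def by auto

text \<open>Stated for a continuous factor because it is applied both to a test function and to its
  derivative, which is merely continuous.\<close>

lemma set_integrable_scaleR_locally_integrable:
  assumes f: "locally_integrable_on f {0<..}" and "0 < a"
    and g: "continuous_on UNIV g" "\<And>t. t \<notin> {a<..<b} \<Longrightarrow> g t = 0"
  shows "set_integrable lebesgue {0<..} (\<lambda>t. g t *\<^sub>R f t)"
proof -
  have "f absolutely_integrable_on {a..b}"
    using f \<open>0 < a\<close> compact_Icc[of a b] unfolding locally_integrable_on_def
    by (simp add: subset_iff)
  moreover have "continuous_on {a..b} g"
    using g(1) continuous_on_subset by blast
  ultimately have "(\<lambda>t. g t *\<^sub>R f t) absolutely_integrable_on {a..b}"
    by (intro absolutely_integrable_bounded_measurable_product[of scaleR])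
      (auto simp: bilinear_conv_bounded_bilinear bounded_bilinear_scaleR
        intro!: continuous_imp_measurable_on_sets_lebesgue compact_imp_bounded compact_continuous_image)
  moreover have "indicator {0<..} t *\<^sub>R g t *\<^sub>R f t = indicator {a..b} t *\<^sub>R g t *\<^sub>R f t" for t
    using \<open>0 < a\<close> g(2)[of t] by (cases "t \<in> {a<..<b}") auto
  ultimately show ?thesis
    unfolding set_integrable_def by (simp only:)
qed

lemma set_integrable_test_function:
  assumes "locally_integrable_on f {0<..}" and "test_function_on {0<..} \<eta>"
  shows "set_integrable lebesgue {0<..} (\<lambda>t. \<eta> t *\<^sub>R f t)"
    and "set_integrable lebesgue {0<..} (\<lambda>t. deriv \<eta> t *\<^sub>R f t)"
  by (rule test_function_on_halflineE[OF assms(2)],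
      rule set_integrable_scaleR_locally_integrable[OF assms(1)]; assumption)+

lemma has_weak_derivative_on_add_scaleR:
  assumes "has_weak_derivative_on f v {0<..}" and "has_weak_derivative_on g w {0<..}"
  shows "has_weak_derivative_on (\<lambda>t. f t + c *\<^sub>R g t) (\<lambda>t. v t + c *\<^sub>R w t) {0<..}"
proof -
  note * = assms[unfolded has_weak_derivative_on_def]
  have "(LINT t:{0<..}|lebesgue. deriv \<eta> t *\<^sub>R (f t + c *\<^sub>R g t)) =
      - (LINT t:{0<..}|lebesgue. \<eta> t *\<^sub>R (v t + c *\<^sub>R w t))" if \<eta>: "test_function_on {0<..} \<eta>" for \<eta>
  proof -
    have f: "locally_integrable_on f {0<..}" and g: "locally_integrable_on g {0<..}"
      and v: "locally_integrable_on v {0<..}" and w: "locally_integrable_on w {0<..}"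
      using * by auto
    note int = set_integrable_test_function[OF _ \<eta>]
    have "(LINT t:{0<..}|lebesgue. deriv \<eta> t *\<^sub>R (f t + c *\<^sub>R g t)) =
        (LINT t:{0<..}|lebesgue. deriv \<eta> t *\<^sub>R f t + c *\<^sub>R (deriv \<eta> t *\<^sub>R g t))"
      by (simp add: scaleR_add_right mult.commute)
    also have "\<dots> = (LINT t:{0<..}|lebesgue. deriv \<eta> t *\<^sub>R f t) + c *\<^sub>R (LINT t:{0<..}|lebesgue. deriv \<eta> t *\<^sub>R g t)"
      by (simp only: set_integral_add(2)[OF int(2)[OF f] set_integrable_scaleR_right[OF int(2)[OF g]]]
          set_integral_scaleR_right)
    also have "\<dots> = - ((LINT t:{0<..}|lebesgue. \<eta> t *\<^sub>R v t) + c *\<^sub>R (LINT t:{0<..}|lebesgue. \<eta> t *\<^sub>R w t))"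
      using * \<eta> by simp
    also have "\<dots> = - (LINT t:{0<..}|lebesgue. \<eta> t *\<^sub>R v t + c *\<^sub>R (\<eta> t *\<^sub>R w t))"
      by (simp only: set_integral_add(2)[OF int(1)[OF v] set_integrable_scaleR_right[OF int(1)[OF w]]]
          set_integral_scaleR_right)
    finally show ?thesis
      by (simp add: scaleR_add_right mult.commute)
  qed
  then show ?thesis
    unfolding has_weak_derivative_on_def using * by (auto intro: locally_integrable_on_add_scaleR)
qed

text \<open>The passage to the gauge integral over a compact interval, where the fundamental theorem
  of calculus and the Leibniz rule apply.\<close>

lemma set_integral_halfline_compact_support:
  fixes f :: "real \<Rightarrow> 'a::euclidean_space"
  assumes "0 < a" and f: "continuous_on {a..b} f" "\<And>t. t \<notin> {a<..<b} \<Longrightarrow> f t = 0"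
  shows "set_integrable lebesgue {0<..} f" and "(LINT t:{0<..}|lebesgue. f t) = integral {a..b} f"
proof -
  have eq: "indicator {0<..} t *\<^sub>R f t = indicator {a..b} t *\<^sub>R f t" for t
    using \<open>0 < a\<close> f(2)[of t] by (cases "t \<in> {a<..<b}") auto
  have int: "f absolutely_integrable_on {a..b}"
    using f(1) by (rule absolutely_integrable_continuous_real)
  then show "set_integrable lebesgue {0<..} f"
    unfolding set_integrable_def eq .
  have "(LINT t:{0<..}|lebesgue. f t) = (LINT t:{a..b}|lebesgue. f t)"
    unfolding set_lebesgue_integral_def eq ..
  also have "\<dots> = integral {a..b} f"
    by (rule set_lebesgue_integral_eq_integral(2)[OF int])
  finally show "(LINT t:{0<..}|lebesgue. f t) = integral {a..b} f" .
qed

text \<open>Integration by parts: \<open>\<eta> t *\<^sub>R G t\<close> vanishes at both ends of an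
  interval enclosing the support, so its derivative has integral 0.\<close>

lemma C1_has_weak_derivative_on:
  fixes G :: "real \<Rightarrow> 'a::euclidean_space"
  assumes G: "\<And>t. 0 < t \<Longrightarrow> (G has_vector_derivative g t) (at t)" and g: "continuous_on {0<..} g"
  shows "has_weak_derivative_on G g {0<..}"
proof -
  have G_cont: "continuous_on {0<..} G"
    using G by (intro continuous_at_imp_continuous_on) (auto intro: has_vector_derivative_continuous)
  have "(LINT t:{0<..}|lebesgue. deriv \<eta> t *\<^sub>R G t) = - (LINT t:{0<..}|lebesgue. \<eta> t *\<^sub>R g t)"
    if \<eta>: "test_function_on {0<..} \<eta>" for \<eta>
  proof -
    note int = set_integrable_test_function[OF continuous_imp_locally_integrable_on \<eta>]
    obtain a b where ab: "0 < a" "a < b"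
      "\<And>t. t \<notin> {a<..<b} \<Longrightarrow> \<eta> t = 0" "\<And>t. t \<notin> {a<..<b} \<Longrightarrow> deriv \<eta> t = 0"
      "\<And>t. (\<eta> has_real_derivative deriv \<eta> t) (at t)"
      "continuous_on UNIV \<eta>" "continuous_on UNIV (deriv \<eta>)"
      by (rule test_function_on_halflineE[OF \<eta>]) blast
    let ?f = "\<lambda>t. \<eta> t *\<^sub>R g t + deriv \<eta> t *\<^sub>R G t"
    have "continuous_on {a..b} ?f"
      by (intro continuous_intros continuous_on_subset[OF ab(6)] continuous_on_subset[OF ab(7)]
          continuous_on_subset[OF G_cont] continuous_on_subset[OF g]) (use \<open>0 < a\<close> in auto)
    then have "(LINT t:{0<..}|lebesgue. ?f t) = integral {a..b} ?f"
      using ab by (intro set_integral_halfline_compact_support(2)) auto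
    also have "(?f has_integral \<eta> b *\<^sub>R G b - \<eta> a *\<^sub>R G a) {a..b}"
    proof (rule fundamental_theorem_of_calculus)
      show "((\<lambda>t. \<eta> t *\<^sub>R G t) has_vector_derivative ?f t) (at t within {a..b})"
        if "t \<in> {a..b}" for t
        using that \<open>0 < a\<close>
        by (intro has_vector_derivative_at_within[OF has_vector_derivative_scaleR[OF ab(5) G]]) auto
    qed (use ab in auto)
    then have "integral {a..b} ?f = 0"
      using ab(3)[of a] ab(3)[of b] by (simp add: integral_unique)
    finally have "(LINT t:{0<..}|lebesgue. \<eta> t *\<^sub>R g t) + (LINT t:{0<..}|lebesgue. deriv \<eta> t *\<^sub>R G t) = 0"
      by (subst (asm) set_integral_add) (auto intro: int G_cont g)
    then show ?thesis
      by (simp add: add_eq_0_iff)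
  qed
  then show ?thesis
    unfolding has_weak_derivative_on_def
    using continuous_imp_locally_integrable_on G_cont g by blast
qed

section \<open>Cutoffs and the fundamental lemma\<close>

text \<open>Squaring removes the kink of the positive part: at 0 the difference quotient is at most
  |h|. This is why the cutoffs are built from squares.\<close>

lemma DERIV_max_0_power2: "((\<lambda>x. (max 0 x)\<^sup>2) has_real_derivative 2 * max 0 x) (at x)"
proof (cases x "0::real" rule: linorder_cases)
  case less
  show ?thesis
    by (rule has_field_derivative_transform_within_open[where S = "{..<0}" and f = "\<lambda>_. 0"])
      (use less in auto)
next
  case equal
  have "((\<lambda>h. (max 0 h)\<^sup>2 / h) \<longlongrightarrow> 0) (at (0::real))"
  proof (rule Lim_null_comparison)
    show "\<forall>\<^sub>F h in at 0. norm ((max 0 h)\<^sup>2 / h) \<le> \<bar>h\<bar>"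
      by (rule always_eventually) (auto simp: max_def power2_eq_square)
    show "((\<lambda>h. \<bar>h\<bar>) \<longlongrightarrow> 0) (at (0::real))"
      by (rule tendsto_rabs_zero) (rule tendsto_ident_at)
  qed
  then show ?thesis
    using equal by (simp add: DERIV_def)
next
  case greater
  have "((\<lambda>x. x\<^sup>2) has_real_derivative 2 * x) (at x)"
    by (auto intro!: derivative_eq_intros)
  then have "((\<lambda>x. (max 0 x)\<^sup>2) has_real_derivative 2 * x) (at x)"
    by (rule has_field_derivative_transform_within_open[where S = "{0<..}"]) (use greater in auto)
  then show ?thesis
    using greater by simp
qed

text \<open>A \<open>C\<^sup>1\<close> approximation of the indicator function of the interval from \<open>s\<close> to \<open>t\<close>: it is
  \<open>k b / (1 + k b)\<close> for the bump \<open>b(x) = (x - s)\<^sub>+\<^sup>2 (t - x)\<^sub>+\<^sup>2\<close>.\<close>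

definition cutoff :: "real \<Rightarrow> real \<Rightarrow> nat \<Rightarrow> real \<Rightarrow> real" where
  "cutoff s t k x = 1 - 1 / (1 + real k * ((max 0 (x - s))\<^sup>2 * (max 0 (t - x))\<^sup>2))"

lemma cutoff_eq_0: "x \<notin> {s<..<t} \<Longrightarrow> cutoff s t k x = 0"
  by (auto simp: cutoff_def max_def)

lemma cutoff_bounds: "0 \<le> cutoff s t k x" "cutoff s t k x \<le> 1"
  by (auto simp: cutoff_def divide_le_eq_1 add_pos_nonneg)

lemma cutoff_tendsto:
  assumes "x \<in> {s<..<t}"
  shows "(\<lambda>k. cutoff s t k x) \<longlonglongrightarrow> 1"
proof -
  define b where "b = (max 0 (x - s))\<^sup>2 * (max 0 (t - x))\<^sup>2"
  have "0 < b" using assms by (auto simp: b_def)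
  then have "filterlim (\<lambda>k. b * real k) at_top sequentially"
    by (intro filterlim_tendsto_pos_mult_at_top[OF tendsto_const _ filterlim_real_sequentially])
  then have "filterlim (\<lambda>k. 1 + real k * b) at_top sequentially"
    by (intro filterlim_tendsto_add_at_top[OF tendsto_const]) (simp add: mult.commute)
  then have "(\<lambda>k. 1 / (1 + real k * b)) \<longlonglongrightarrow> 0"
    by (intro real_tendsto_divide_at_top[OF tendsto_const])
  from tendsto_diff[OF tendsto_const[of 1] this] show ?thesis
    by (simp add: cutoff_def b_def)
qed

lemma test_function_on_cutoff:
  assumes "0 < s"
  shows "test_function_on {0<..} (cutoff s t k)"
proof -
  define b where "b = (\<lambda>x. (max 0 (x - s))\<^sup>2 * (max 0 (t - x))\<^sup>2)"
  define b' where "b' = (\<lambda>x. 2 * max 0 (x - s) * (max 0 (t - x))\<^sup>2 - (max 0 (x - s))\<^sup>2 * (2 * max 0 (t - x)))"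
  have b: "(b has_real_derivative b' x) (at x)" for x
  proof -
    have 1: "((\<lambda>x. (max 0 (x - s))\<^sup>2) has_real_derivative 2 * max 0 (x - s) * 1) (at x)"
      by (rule DERIV_chain2[OF DERIV_max_0_power2]) (auto intro!: derivative_eq_intros)
    have 2: "((\<lambda>x. (max 0 (t - x))\<^sup>2) has_real_derivative 2 * max 0 (t - x) * (- 1)) (at x)"
      by (rule DERIV_chain2[OF DERIV_max_0_power2]) (auto intro!: derivative_eq_intros)
    show ?thesis
      unfolding b_def b'_def by (rule DERIV_cong[OF DERIV_mult[OF 1 2]]) (simp add: algebra_simps)
  qed
  have pos: "0 < 1 + real k * b x" for x
    by (simp add: b_def add_pos_nonneg)
  have b_cont: "continuous_on UNIV b" "continuous_on UNIV b'"
    unfolding b_def b'_def by (intro continuous_intros)+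
  show ?thesis
  proof (rule test_function_onI)
    show "(cutoff s t k has_real_derivative real k * b' x / (1 + real k * b x)\<^sup>2) (at x)" for x
    proof -
      have "((\<lambda>x. 1 - 1 / (1 + real k * b x)) has_real_derivative real k * b' x / (1 + real k * b x)\<^sup>2) (at x)"
        using pos[of x] by (auto intro!: derivative_eq_intros b simp: power2_eq_square)
      then show ?thesis by (simp add: cutoff_def[abs_def] b_def)
    qed
    show "continuous_on UNIV (\<lambda>x. real k * b' x / (1 + real k * b x)\<^sup>2)"
      using pos by (intro continuous_intros b_cont) (auto simp: less_imp_neq[symmetric])
    show "cutoff s t k x = 0" if "x \<notin> {s..t}" for x
      using that by (intro cutoff_eq_0) auto
  qed (use assms in auto)
qed

text \<open>By Lebesgue differentiation the averages of h over \<open>{x..x + l}\<close> tend to h x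
  for almost every x, and here all these averages are 0.\<close>

lemma AE_lebesgue_halfline_zero:
  fixes h :: "real \<Rightarrow> 'a::euclidean_space"
  assumes h: "locally_integrable_on h {0<..}"
    and int: "\<And>s t. 0 < s \<Longrightarrow> s < t \<Longrightarrow> integral {s..t} h = 0"
  shows "AE t in lebesgue. 0 < t \<longrightarrow> h t = 0"
proof -
  \<comment> \<open>The windows [1/(n+1), n+1] exhaust the half-line; \<open>Suc n\<close> avoids a
    division by 0.\<close>
  define a b :: "nat \<Rightarrow> real" where "a = (\<lambda>n. 1 / Suc n)" and "b = (\<lambda>n. Suc n)"
  have a: "0 < a n" for n by (simp add: a_def)
  \<comment> \<open>Extended by 0 outside the window, h is integrable on every interval, as the
    differentiation theorem requires.\<close>
  define hn where "hn = (\<lambda>n t. if t \<in> {a n..b n} then h t else 0)"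
  have "\<exists>N. negligible N \<and> (\<forall>x\<in>{a n<..<b n}. x \<notin> N \<longrightarrow> h x = 0)" for n
  proof -
    have "h absolutely_integrable_on {a n..b n}"
      using h compact_Icc[of "a n" "b n"] a[of n] unfolding locally_integrable_on_def
      by (simp add: subset_iff)
    then have "h integrable_on {a n..b n}"
      by (rule set_lebesgue_integral_eq_integral)
    then have "hn n integrable_on UNIV"
      unfolding hn_def by (subst integrable_restrict_UNIV)
    then have "hn n integrable_on cbox u v" for u v
      by (rule integrable_on_subcbox) simp
    then obtain N where N: "negligible N" "\<And>x e. \<lbrakk>x \<notin> N; 0 < e\<rbrakk> \<Longrightarrow>
        \<exists>d>0. \<forall>l. 0 < l \<and> l < d \<longrightarrow>
          norm (integral (cbox x (x + l *\<^sub>R One)) (hn n) /\<^sub>R l ^ DIM(real) - hn n x) < e"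
      by (rule integrable_ccontinuous_explicit) blast
    have "h x = 0" if x: "a n < x" "x < b n" "x \<notin> N" for x
    proof (rule ccontr)
      assume "h x \<noteq> 0"
      then obtain d where d: "0 < d" "\<And>l. 0 < l \<Longrightarrow> l < d \<Longrightarrow>
          norm (integral {x..x + l} (hn n) /\<^sub>R l - hn n x) < norm (h x)"
        using N(2)[OF x(3), of "norm (h x)"] by auto
      \<comment> \<open>Short enough to keep \<open>{x..x + l}\<close> inside the window, where
        \<open>hn n\<close> agrees with h.\<close>
      define l where "l = min (d / 2) (b n - x)"
      have l: "0 < l" "l < d" "x + l \<le> b n"
        using d(1) x by (auto simp: l_def)
      have "integral {x..x + l} (hn n) = integral {x..x + l} h"
        using l x by (intro integral_cong) (auto simp: hn_def)
      also have "\<dots> = 0"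
        using l x a[of n] by (intro int) auto
      finally show False
        using d(2)[OF l(1,2)] x by (simp add: hn_def)
    qed
    with N(1) show ?thesis by auto
  qed
  then obtain N where N: "\<And>n. negligible (N n)" "\<And>n x. x \<in> {a n<..<b n} \<Longrightarrow> x \<notin> N n \<Longrightarrow> h x = 0"
    by metis
  have "negligible (\<Union>n. N n)"
    by (intro negligible_countable_Union) (auto simp: N(1))
  then have "AE x in lebesgue. x \<notin> (\<Union>n. N n)"
    by (intro AE_not_in) (simp add: negligible_iff_null_sets)
  then show ?thesis
  proof eventually_elim
    case (elim x)
    show ?case
    proof
      assume "0 < x"
      obtain m :: nat where "max (1 / x) x < m"
        using reals_Archimedean2[of "max (1 / x) x"] by blast
      then have "1 < m * x" "x < m"
        using \<open>0 < x\<close> by (auto simp: field_simps)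
      then have "x \<in> {a m<..<b m}"
        using \<open>0 < x\<close> by (auto simp: a_def b_def field_simps)
      with elim show "h x = 0"
        using N(2) by blast
    qed
  qed
qed

text \<open>The cutoffs lie below the indicator of \<open>{s..t}\<close> and converge to that of
  \<open>{s<..<t}\<close>. Dominated convergence then makes the integral of h over every compact
  subinterval 0.\<close>

lemma fundamental_lemma_calculus_of_variations:
  fixes h :: "real \<Rightarrow> 'a::euclidean_space"
  assumes h: "locally_integrable_on h {0<..}"
    and zero: "\<And>\<eta>. test_function_on {0<..} \<eta> \<Longrightarrow> (LINT t:{0<..}|lebesgue. \<eta> t *\<^sub>R h t) = 0"
  shows "AE t in lebesgue. 0 < t \<longrightarrow> h t = 0"
proof (rule AE_lebesgue_halfline_zero[OF h])
  fix s t :: real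
  assume "0 < s" "s < t"
  then have h_st: "h absolutely_integrable_on {s..t}"
    using h compact_Icc[of s t] unfolding locally_integrable_on_def
    by (simp add: subset_iff)
  have "(\<lambda>k. LINT x:{0<..}|lebesgue. cutoff s t k x *\<^sub>R h x) \<longlonglongrightarrow> (LINT x:{s<..<t}|lebesgue. h x)"
    unfolding set_lebesgue_integral_def
  proof (rule integral_dominated_convergence[where w = "\<lambda>x. norm (indicator {s..t} x *\<^sub>R h x)"])
    show "integrable lebesgue (\<lambda>x. norm (indicat_real {s..t} x *\<^sub>R h x))"
      using h_st unfolding set_integrable_def by (rule integrable_norm)
    have "set_integrable lebesgue {s<..<t} h"
      by (rule set_integrable_subset[OF h_st]) auto
    then show "(\<lambda>x. indicat_real {s<..<t} x *\<^sub>R h x) \<in> borel_measurable lebesgue"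
      unfolding set_integrable_def by (rule borel_measurable_integrable)
    show "(\<lambda>x. indicat_real {0<..} x *\<^sub>R cutoff s t k x *\<^sub>R h x) \<in> borel_measurable lebesgue" for k
      using set_integrable_test_function(1)[OF h test_function_on_cutoff[OF \<open>0 < s\<close>, of t k]]
      unfolding set_integrable_def by (rule borel_measurable_integrable)
    show "AE x in lebesgue. (\<lambda>k. indicat_real {0<..} x *\<^sub>R cutoff s t k x *\<^sub>R h x)
        \<longlonglongrightarrow> indicat_real {s<..<t} x *\<^sub>R h x"
    proof (rule AE_I2)
      fix x
      show "(\<lambda>k. indicat_real {0<..} x *\<^sub>R cutoff s t k x *\<^sub>R h x) \<longlonglongrightarrow> indicat_real {s<..<t} x *\<^sub>R h x"
      proof (cases "x \<in> {s<..<t}")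
        case True
        have "(\<lambda>k. cutoff s t k x *\<^sub>R h x) \<longlonglongrightarrow> 1 *\<^sub>R h x"
          by (intro tendsto_scaleR tendsto_const cutoff_tendsto[OF True])
        with True \<open>0 < s\<close> show ?thesis by simp
      next
        case False
        then show ?thesis by (simp add: cutoff_eq_0)
      qed
    qed
    show "AE x in lebesgue. norm (indicat_real {0<..} x *\<^sub>R cutoff s t k x *\<^sub>R h x)
        \<le> norm (indicat_real {s..t} x *\<^sub>R h x)" for k
    proof (rule AE_I2)
      fix x
      show "norm (indicat_real {0<..} x *\<^sub>R cutoff s t k x *\<^sub>R h x) \<le> norm (indicat_real {s..t} x *\<^sub>R h x)"
        using \<open>0 < s\<close> cutoff_bounds[of s t k x] cutoff_eq_0[of x s t k]
        by (cases "x \<in> {s<..<t}") (auto intro: mult_left_le_one_le)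
    qed
  qed
  then have 0: "(LINT x:{s<..<t}|lebesgue. h x) = 0"
    unfolding zero[OF test_function_on_cutoff[OF \<open>0 < s\<close>]] by (simp add: LIMSEQ_const_iff)
  have "(LINT x:{s<..<t}|lebesgue. h x) = integral {s<..<t} h"
    by (intro set_lebesgue_integral_eq_integral set_integrable_subset[OF h_st]) auto
  also have "integral {s<..<t} h = integral {s..t} h"
    by (rule integral_spike_set; rule negligible_subset[of "{s, t}"]) auto
  finally show "integral {s..t} h = 0"
    using 0 by simp
qed

lemma weak_derivative_AE_unique:
  fixes f :: "real \<Rightarrow> 'a::euclidean_space"
  assumes "has_weak_derivative_on f v {0<..}" and "has_weak_derivative_on f w {0<..}"
  shows "AE t in lebesgue. 0 < t \<longrightarrow> v t = w t"
proof -
  have "has_weak_derivative_on (\<lambda>t. f t + (- 1) *\<^sub>R f t) (\<lambda>t. v t + (- 1) *\<^sub>R w t) {0<..}"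
    by (rule has_weak_derivative_on_add_scaleR[OF assms])
  then have *: "has_weak_derivative_on (\<lambda>t. 0) (\<lambda>t. v t - w t) {0<..}"
    by simp
  have "AE t in lebesgue. 0 < t \<longrightarrow> v t - w t = 0"
    using * unfolding has_weak_derivative_on_def
    by (intro fundamental_lemma_calculus_of_variations) (auto simp: set_lebesgue_integral_def)
  then show ?thesis by simp
qed

text \<open>Subtracting from a test function a multiple of a fixed test function with nonzero integral
  leaves a function of integral zero, whose antiderivative is again a test function.\<close>

lemma du_bois_reymond:
  fixes h :: "real \<Rightarrow> 'a::euclidean_space"
  assumes h: "has_weak_derivative_on h (\<lambda>_. 0) {0<..}"
  obtains c where "AE t in lebesgue. 0 < t \<longrightarrow> h t = c"
proof -
  have h_int: "locally_integrable_on h {0<..}"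
    and zero: "\<And>\<eta>. test_function_on {0<..} \<eta> \<Longrightarrow> (LINT t:{0<..}|lebesgue. deriv \<eta> t *\<^sub>R h t) = 0"
    using h by (auto simp: has_weak_derivative_on_def set_lebesgue_integral_def)
  let ?I = "\<lambda>\<eta>. LINT t:{0<..}|lebesgue. \<eta> t"
  have one: "locally_integrable_on (\<lambda>t. 1::real) {0<..}"
    by (rule continuous_imp_locally_integrable_on) auto
  have int1: "set_integrable lebesgue {0<..} \<zeta>" if "test_function_on {0<..} \<zeta>" for \<zeta>
    using set_integrable_test_function(1)[OF one that] by simp
  \<comment> \<open>No explicit integral is computed: if every test function had integral 0, the
    fundamental lemma applied to the constant 1 would give 1 = 0 almost everywhere.\<close>
  obtain \<zeta>0 where \<zeta>0: "test_function_on {0<..} \<zeta>0" "?I \<zeta>0 \<noteq> 0"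
  proof (rule ccontr)
    assume "\<not> thesis"
    with that have *: "?I \<eta> = 0" if "test_function_on {0<..} \<eta>" for \<eta>
      using that by blast
    have "AE t in lebesgue. (0::real) < t \<longrightarrow> (1::real) = 0"
      by (rule fundamental_lemma_calculus_of_variations[OF one]) (simp add: *)
    then have "AE t in lebesgue. t \<notin> {0<..<1::real}"
      by eventually_elim auto
    then have "negligible {0<..<1::real}"
      by (simp add: AE_iff_null_sets negligible_iff_null_sets)
    then show False
      using negligible_interval(2)[of 0 "1::real"] by (simp add: box_real)
  qed
  obtain a0 b0 where ab0: "0 < a0" "a0 < b0"
    "\<And>t. t \<notin> {a0<..<b0} \<Longrightarrow> \<zeta>0 t = 0" "\<And>t. t \<notin> {a0<..<b0} \<Longrightarrow> deriv \<zeta>0 t = 0"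
    "\<And>t. (\<zeta>0 has_real_derivative deriv \<zeta>0 t) (at t)"
    "continuous_on UNIV \<zeta>0" "continuous_on UNIV (deriv \<zeta>0)"
    by (rule test_function_on_halflineE[OF \<zeta>0(1)]) blast
  \<comment> \<open>The only possible value: a constant h would satisfy this identity after testing
    with \<zeta>0.\<close>
  define c where "c = (1 / ?I \<zeta>0) *\<^sub>R (LINT t:{0<..}|lebesgue. \<zeta>0 t *\<^sub>R h t)"
  have "AE t in lebesgue. 0 < t \<longrightarrow> h t + (- 1) *\<^sub>R c = 0"
  proof (rule fundamental_lemma_calculus_of_variations)
    show c_int: "locally_integrable_on (\<lambda>t. h t + (- 1) *\<^sub>R c) {0<..}"
      by (intro locally_integrable_on_add_scaleR h_int continuous_imp_locally_integrable_on) auto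
    fix \<zeta> assume \<zeta>: "test_function_on {0<..} \<zeta>"
    obtain a1 b1 where ab1: "0 < a1" "a1 < b1"
      "\<And>t. t \<notin> {a1<..<b1} \<Longrightarrow> \<zeta> t = 0" "\<And>t. t \<notin> {a1<..<b1} \<Longrightarrow> deriv \<zeta> t = 0"
      "\<And>t. (\<zeta> has_real_derivative deriv \<zeta> t) (at t)"
      "continuous_on UNIV \<zeta>" "continuous_on UNIV (deriv \<zeta>)"
      by (rule test_function_on_halflineE[OF \<zeta>]) blast
    define a b where "a = min a0 a1" and "b = max b0 b1"
    \<comment> \<open>m makes the integral of \<kappa> vanish.\<close>
    define m where "m = ?I \<zeta> / ?I \<zeta>0"
    define \<kappa> where "\<kappa> = (\<lambda>t. \<zeta> t - m * \<zeta>0 t)"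
    have ab: "0 < a" "a < b"
      using ab0(1,2) ab1(1,2) by (auto simp: a_def b_def)
    have \<kappa>_0: "\<kappa> t = 0" if "t \<notin> {a<..<b}" for t
    proof -
      have "t \<notin> {a0<..<b0}" "t \<notin> {a1<..<b1}"
        using that by (auto simp: a_def b_def)
      then show ?thesis
        using ab0(3) ab1(3) by (simp add: \<kappa>_def)
    qed
    have \<kappa>_cont: "continuous_on UNIV \<kappa>"
      unfolding \<kappa>_def by (intro continuous_intros ab0 ab1)
    obtain F where F: "\<And>t. (F has_real_derivative \<kappa> t) (at t)"
      using einterval_antiderivative[of "- \<infinity>" "\<infinity>" \<kappa>] \<kappa>_cont
      by (auto simp: continuous_on_eq_continuous_at has_real_derivative_iff_has_vector_derivative)
    have F_diff: "(\<kappa> has_integral F t - F s) {s..t}" if "s \<le> t" for s t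
      using F that
      by (intro fundamental_theorem_of_calculus)
        (auto simp: has_real_derivative_iff_has_vector_derivative intro: has_vector_derivative_at_within)
    have "?I \<kappa> = ?I \<zeta> - m * ?I \<zeta>0"
      unfolding \<kappa>_def by (simp add: int1 \<zeta> \<zeta>0 set_integral_diff)
    then have "?I \<kappa> = 0"
      using \<zeta>0(2) by (simp add: m_def)
    moreover have "?I \<kappa> = integral {a..b} \<kappa>"
      by (intro set_integral_halfline_compact_support(2) ab \<kappa>_0 continuous_on_subset[OF \<kappa>_cont]) auto
    ultimately have "F b = F a"
      using integral_unique[OF F_diff[of a b]] ab by simp
    \<comment> \<open>To the left of a this holds because \<kappa> is 0 there; to the right of b it
      also uses F b = F a, that is, the vanishing integral.\<close>
    have "F t - F a = 0" if "t \<notin> {a..b}" for t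
    proof (cases "t < a")
      case True
      have "(\<kappa> has_integral 0) {t..a}"
        by (rule has_integral_is_0) (use \<kappa>_0 in auto)
      from has_integral_unique[OF this F_diff] True show ?thesis by simp
    next
      case False
      with that have "b \<le> t" by simp
      have "(\<kappa> has_integral 0) {b..t}"
        by (rule has_integral_is_0) (use \<kappa>_0 in auto)
      from has_integral_unique[OF this F_diff] \<open>b \<le> t\<close> \<open>F b = F a\<close> show ?thesis by simp
    qed
    moreover have der: "((\<lambda>t. F t - F a) has_real_derivative \<kappa> t) (at t)" for t
      using F by (auto intro!: derivative_eq_intros)
    ultimately have "test_function_on {0<..} (\<lambda>t. F t - F a)"
      using ab by (intro test_function_onI[OF _ \<kappa>_cont, where C = "{a..b}"]) auto
    from zero[OF this] have "(LINT t:{0<..}|lebesgue. \<kappa> t *\<^sub>R h t) = 0"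
      by (simp add: DERIV_imp_deriv[OF der])
    moreover have "(LINT t:{0<..}|lebesgue. \<kappa> t *\<^sub>R h t) =
        (LINT t:{0<..}|lebesgue. \<zeta> t *\<^sub>R h t - m *\<^sub>R (\<zeta>0 t *\<^sub>R h t))"
      by (simp add: \<kappa>_def scaleR_diff_left)
    moreover have "\<dots> = (LINT t:{0<..}|lebesgue. \<zeta> t *\<^sub>R h t) - m *\<^sub>R (LINT t:{0<..}|lebesgue. \<zeta>0 t *\<^sub>R h t)"
      by (simp only: set_integral_diff(2)[OF set_integrable_test_function(1)[OF h_int \<zeta>]
            set_integrable_scaleR_right[OF set_integrable_test_function(1)[OF h_int \<zeta>0(1)]]]
          set_integral_scaleR_right)
    ultimately have 1: "(LINT t:{0<..}|lebesgue. \<zeta> t *\<^sub>R h t) = ?I \<zeta> *\<^sub>R c"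
      by (simp add: m_def c_def)
    have "(LINT t:{0<..}|lebesgue. \<zeta> t *\<^sub>R (h t + (- 1) *\<^sub>R c)) =
        (LINT t:{0<..}|lebesgue. \<zeta> t *\<^sub>R h t - \<zeta> t *\<^sub>R c)"
      by (simp add: scaleR_diff_right)
    also have "\<dots> = (LINT t:{0<..}|lebesgue. \<zeta> t *\<^sub>R h t) - (LINT t:{0<..}|lebesgue. \<zeta> t *\<^sub>R c)"
      by (intro set_integral_diff(2) set_integrable_test_function(1)[OF _ \<zeta>] h_int
          continuous_imp_locally_integrable_on continuous_on_const)
    also have "(LINT t:{0<..}|lebesgue. \<zeta> t *\<^sub>R c) = ?I \<zeta> *\<^sub>R c"
      using int1[OF \<zeta>] unfolding set_lebesgue_integral_def set_integrable_def
      by (simp flip: integral_scaleR_left scaleR_scaleR)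
    finally show "(LINT t:{0<..}|lebesgue. \<zeta> t *\<^sub>R (h t + (- 1) *\<^sub>R c)) = 0"
      using 1 by simp
  qed
  then show ?thesis
    by (intro that[of c]) simp
qed

section \<open>From weak to classical derivatives\<close>

text \<open>Subtracting a classical antiderivative of g leaves a function with weak derivative 0,
  which is constant by du Bois-Reymond.\<close>

lemma weak_derivative_continuous_imp_AE_C1:
  fixes h :: "real \<Rightarrow> 'a::euclidean_space"
  assumes h: "has_weak_derivative_on h g {0<..}" and g: "continuous_on {0<..} g"
  obtains H where "\<And>t. 0 < t \<Longrightarrow> (H has_vector_derivative g t) (at t)"
    and "AE t in lebesgue. 0 < t \<longrightarrow> h t = H t"
proof -
  obtain G where G: "\<And>t. 0 < t \<Longrightarrow> (G has_vector_derivative g t) (at t)"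
    using einterval_antiderivative[of 0 "\<infinity>" g] g
    by (auto simp: continuous_on_eq_continuous_at zero_ereal_def)
  have "has_weak_derivative_on (\<lambda>t. h t + (- 1) *\<^sub>R G t) (\<lambda>t. g t + (- 1) *\<^sub>R g t) {0<..}"
    by (intro has_weak_derivative_on_add_scaleR h C1_has_weak_derivative_on G g)
  then have "has_weak_derivative_on (\<lambda>t. h t + (- 1) *\<^sub>R G t) (\<lambda>t. 0) {0<..}"
    by simp
  then obtain c where "AE t in lebesgue. 0 < t \<longrightarrow> h t + (- 1) *\<^sub>R G t = c"
    by (rule du_bois_reymond)
  then have "AE t in lebesgue. 0 < t \<longrightarrow> h t = G t + c"
    by eventually_elim (auto simp: algebra_simps)
  moreover have "((\<lambda>t. G t + c) has_vector_derivative g t) (at t)" if "0 < t" for t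
    using G[OF that] by (auto intro!: derivative_eq_intros)
  ultimately show ?thesis
    by (intro that[of "\<lambda>t. G t + c"])
qed

lemma has_weak_derivative_on_cong:
  assumes "has_weak_derivative_on f v {0<..}" and "\<And>t. 0 < t \<Longrightarrow> f t = g t"
  shows "has_weak_derivative_on g v {0<..}"
proof -
  have "f absolutely_integrable_on C \<longleftrightarrow> g absolutely_integrable_on C" if "C \<subseteq> {0<..}" for C
    using that assms(2) by (intro set_integrable_cong) auto
  moreover have "(LINT t:{0<..}|lebesgue. deriv \<eta> t *\<^sub>R f t) = (LINT t:{0<..}|lebesgue. deriv \<eta> t *\<^sub>R g t)" for \<eta>
    using assms(2) by (intro set_lebesgue_integral_cong) auto
  ultimately show ?thesis
    using assms(1) unfolding has_weak_derivative_on_def locally_integrable_on_def by auto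
qed

text \<open>Exchanges a weak derivative for its continuous representative; continuity supplies the
  local integrability that the definition demands.\<close>

lemma has_weak_derivative_on_AE:
  assumes f: "has_weak_derivative_on f v {0<..}" and w: "continuous_on {0<..} w"
    and ae: "AE t in lebesgue. 0 < t \<longrightarrow> v t = w t"
  shows "has_weak_derivative_on f w {0<..}"
proof -
  have v: "locally_integrable_on v {0<..}"
    using f unfolding has_weak_derivative_on_def by blast
  have "(LINT t:{0<..}|lebesgue. \<eta> t *\<^sub>R w t) = (LINT t:{0<..}|lebesgue. \<eta> t *\<^sub>R v t)"
    if "test_function_on {0<..} \<eta>" for \<eta>
  proof (rule set_integral_lebesgue_AE(2)[OF set_integrable_test_function(1)[OF v that]])
    show "AE t in lebesgue. t \<in> {0<..} \<longrightarrow> \<eta> t *\<^sub>R v t = \<eta> t *\<^sub>R w t"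
      using ae by eventually_elim auto
  qed
  then show ?thesis
    using f continuous_imp_locally_integrable_on[OF w] unfolding has_weak_derivative_on_def by simp
qed

text \<open>The set of disagreement is open and null, hence empty.\<close>

lemma AE_eq_imp_eq_on_halfline:
  fixes f g :: "real \<Rightarrow> 'a::real_normed_vector"
  assumes f: "continuous_on {0<..} f" and g: "continuous_on {0<..} g"
    and ae: "AE t in lebesgue. 0 < t \<longrightarrow> f t = g t" and "0 < t"
  shows "f t = g t"
proof (rule ccontr)
  assume "f t \<noteq> g t"
  let ?S = "{0<..} \<inter> (\<lambda>t. f t - g t) -` (- {0})"
  have "open ?S"
    by (rule continuous_open_preimage) (auto intro: continuous_on_diff f g)
  moreover have "?S \<noteq> {}"
    using \<open>0 < t\<close> \<open>f t \<noteq> g t\<close> by auto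
  ultimately have "\<not> negligible ?S"
    by (rule open_not_negligible)
  moreover have "AE t in lebesgue. t \<notin> ?S"
    using ae by eventually_elim auto
  then have "negligible ?S"
    using \<open>open ?S\<close> by (simp add: AE_iff_null_sets negligible_iff_null_sets lebesgue_openin)
  ultimately show False by blast
qed

text \<open>Continuity of f leaves no freedom on null sets, so f equals the classical antiderivative
  at every positive time.\<close>

lemma weak_derivative_continuous_imp_C1:
  fixes f :: "real \<Rightarrow> 'a::euclidean_space"
  assumes f: "has_weak_derivative_on f w {0<..}" "continuous_on {0<..} f"
    and w: "continuous_on {0<..} w" and "0 < t"
  shows "(f has_vector_derivative w t) (at t)"
proof -
  obtain F where F: "\<And>t. 0 < t \<Longrightarrow> (F has_vector_derivative w t) (at t)"
    and ae: "AE t in lebesgue. 0 < t \<longrightarrow> f t = F t"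
    by (rule weak_derivative_continuous_imp_AE_C1[OF f(1) w]) blast
  have "continuous_on {0<..} F"
    using F by (intro continuous_at_imp_continuous_on) (auto intro: has_vector_derivative_continuous)
  then have "f s = F s" if "0 < s" for s
    using AE_eq_imp_eq_on_halfline[OF f(2) _ ae that] by blast
  then show ?thesis
    using has_vector_derivative_transform_within_open[OF F[OF \<open>0 < t\<close>], of "{0<..}" f] \<open>0 < t\<close> by auto
qed

section \<open>The covering map of the torus\<close>

lemma torus_proj_eq_iff:
  "torus_proj x = torus_proj y \<longleftrightarrow> (\<forall>i. \<exists>k::int. x $ i - y $ i = 2 * pi * of_int k)"
  by (simp add: torus_proj_def vec_eq_iff circle.abs_eq_iff circle_rel_def)

lemma torus_proj_translate:
  assumes "torus_proj x = torus_proj y"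
  shows "torus_proj (x + h) = torus_proj (y + h)"
  using assms by (simp add: torus_proj_eq_iff)

lemma continuous_on_torus_proj:
  assumes "continuous_on S f"
  shows "continuous_on S (\<lambda>t. torus_proj (f t))"
proof -
  have abs: "continuous_on UNIV abs_circle"
    by (simp add: continuous_on_open_vimage open_circle_def)
  have "continuous_on S (\<lambda>t. abs_circle (f t $ i))" for i
    by (rule continuous_on_compose2[OF abs continuous_on_component[OF assms]]) simp
  then show ?thesis
    unfolding torus_proj_def by (rule continuous_on_vec_lambda)
qed

text \<open>The closed cube is compact and meets every fibre; compactness arguments run on it
  instead of the torus.\<close>

lemma torus_proj_surj_box:
  obtains x where "torus_proj x = p" and "x \<in> cbox 0 (\<chi> i. 2 * pi)"
proof -
  have "\<exists>u. abs_circle u = c \<and> 0 \<le> u \<and> u \<le> 2 * pi" for c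
  proof -
    obtain v where v: "abs_circle v = c"
      using Quotient_abs_rep[OF Quotient_circle] by blast
    define u where "u = 2 * pi * frac (v / (2 * pi))"
    have "circle_rel u v"
      unfolding circle_rel_def u_def frac_def
      by (rule exI[of _ "- \<lfloor>v / (2 * pi)\<rfloor>"]) (simp add: right_diff_distrib)
    then have "abs_circle u = c"
      using v by (simp add: circle.abs_eq_iff[symmetric])
    moreover have "0 \<le> u" "u \<le> 2 * pi"
      unfolding u_def using frac_ge_0[of "v / (2 * pi)"] frac_lt_1[of "v / (2 * pi)"]
      by (auto intro!: mult_left_le)
    ultimately show ?thesis by blast
  qed
  then obtain u where u: "\<And>c. abs_circle (u c) = c" "\<And>c. 0 \<le> u c" "\<And>c. u c \<le> 2 * pi"
    by metis
  show ?thesis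
    by (rule that[of "\<chi> i. u (p $ i)"]) (simp_all add: torus_proj_def vec_eq_iff u mem_box_cart)
qed

lemma torus_invariant_bounded:
  fixes h :: "real ^ 'n \<Rightarrow> 'a::real_normed_vector"
  assumes "continuous_on UNIV h" and "\<And>x y. torus_proj x = torus_proj y \<Longrightarrow> h x = h y"
  obtains B where "\<And>x. norm (h x) \<le> B"
proof -
  have "bounded (h ` cbox 0 (\<chi> i. 2 * pi))"
    by (intro compact_imp_bounded compact_continuous_image continuous_on_subset[OF assms(1)]) auto
  then obtain B where B: "\<And>x. x \<in> cbox 0 (\<chi> i. 2 * pi) \<Longrightarrow> norm (h x) \<le> B"
    unfolding bounded_iff by blast
  have "norm (h x) \<le> B" for x
    using assms(2) B torus_proj_surj_box[of "torus_proj x"] by metis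
  then show ?thesis by (rule that)
qed

text \<open>One constant serves two whole fibres. Distinct lifts of the same point differ by at
  least 2 pi in some coordinate. For different points some coordinate difference avoids the
  multiples of 2 pi, and its distance to them is the same for all lifts.\<close>

lemma torus_fibers_separated:
  fixes p q :: "circle ^ 'n"
  obtains \<delta> where "0 < \<delta>"
    and "\<And>x y. torus_proj x = p \<Longrightarrow> torus_proj y = q \<Longrightarrow> x \<noteq> y \<Longrightarrow> \<delta> \<le> dist x y"
proof (cases "p = q")
  case True
  have "2 * pi \<le> dist x y" if xy: "torus_proj x = p" "torus_proj y = q" "x \<noteq> y" for x y
  proof -
    obtain i where "x $ i \<noteq> y $ i"
      using xy by (auto simp: vec_eq_iff)
    moreover obtain k :: int where k: "x $ i - y $ i = 2 * pi * of_int k"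
      using xy True torus_proj_eq_iff by metis
    ultimately have "k \<noteq> 0" by auto
    then have "1 \<le> \<bar>real_of_int k\<bar>" by linarith
    then have "2 * pi \<le> \<bar>x $ i - y $ i\<bar>"
      unfolding k by (simp add: abs_mult)
    also have "\<dots> \<le> dist x y"
      using component_le_norm_cart[of "x - y" i] by (simp add: dist_norm)
    finally show ?thesis .
  qed
  then show ?thesis by (intro that[of "2 * pi"]) auto
next
  case False
  then obtain i where i: "p $ i \<noteq> q $ i"
    by (auto simp: vec_eq_iff)
  obtain a b where ab: "torus_proj a = p" "torus_proj b = q"
    by (metis torus_proj_surj_box)
  define r where "r = (a $ i - b $ i) / (2 * pi)"
  have "r \<notin> \<int>"
  proof
    assume "r \<in> \<int>"
    then obtain k where "r = of_int k" by (rule Ints_cases)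
    then have "circle_rel (a $ i) (b $ i)"
      unfolding circle_rel_def r_def by (intro exI[of _ k]) (simp add: field_simps)
    then show False
      using i ab by (auto simp: torus_proj_def circle.abs_eq_iff)
  qed
  \<comment> \<open>The minimum is the distance from r to the nearest integer.\<close>
  define \<delta> where "\<delta> = 2 * pi * min (frac r) (1 - frac r)"
  have "0 < \<delta>"
    unfolding \<delta>_def using \<open>r \<notin> \<int>\<close> frac_lt_1[of r] by (simp add: frac_gt_0_iff)
  moreover have "\<delta> \<le> dist x y" if xy: "torus_proj x = p" "torus_proj y = q" for x y
  proof -
    obtain k :: int where k: "x $ i - a $ i = 2 * pi * of_int k"
      using xy(1) ab(1) torus_proj_eq_iff by metis
    obtain l :: int where l: "y $ i - b $ i = 2 * pi * of_int l"
      using xy(2) ab(2) torus_proj_eq_iff by metis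
    have "x $ i - y $ i = 2 * pi * (r + of_int (k - l))"
      using k l by (simp add: r_def field_simps)
    moreover have "min (frac r) (1 - frac r) \<le> \<bar>r + of_int (k - l)\<bar>"
    proof -
      have r: "r = of_int \<lfloor>r\<rfloor> + frac r" by (simp add: frac_def)
      have "0 \<le> \<lfloor>r\<rfloor> + (k - l) \<or> \<lfloor>r\<rfloor> + (k - l) \<le> - 1" by linarith
      then have "0 \<le> real_of_int (\<lfloor>r\<rfloor> + (k - l)) \<or> real_of_int (\<lfloor>r\<rfloor> + (k - l)) \<le> - 1"
        by linarith
      with r frac_ge_0[of r] frac_lt_1[of r] show ?thesis
        by (auto simp: min_def)
    qed
    ultimately have "\<delta> \<le> \<bar>x $ i - y $ i\<bar>"
      by (simp add: \<delta>_def abs_mult)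
    also have "\<dots> \<le> dist x y"
      using component_le_norm_cart[of "x - y" i] by (simp add: dist_norm)
    finally show ?thesis .
  qed
  ultimately show ?thesis by (intro that)
qed

text \<open>Each of the finitely many pairs of fibres has its own constant, and smaller positive
  constants work too. Choosing in the filter \<open>at_right 0\<close> combines them and covers the
  empty set as well.\<close>

lemma torus_finite_fibers_separated:
  fixes Z :: "(circle ^ 'n) set"
  assumes "finite Z"
  obtains \<delta> where "0 < \<delta>"
    and "\<And>x y. torus_proj x \<in> Z \<Longrightarrow> torus_proj y \<in> Z \<Longrightarrow> x \<noteq> y \<Longrightarrow> \<delta> \<le> dist x y"
proof -
  let ?P = "\<lambda>\<delta> pq. \<forall>x y. torus_proj x = fst pq \<longrightarrow> torus_proj y = snd pq \<longrightarrow> x \<noteq> y \<longrightarrow> \<delta> \<le> dist x y"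
  have "\<forall>pq\<in>Z \<times> Z. \<forall>\<^sub>F \<delta> in at_right 0. ?P \<delta> pq"
  proof
    fix pq :: "(circle ^ 'n) \<times> (circle ^ 'n)"
    obtain \<delta> where \<delta>: "0 < \<delta>" "?P \<delta> pq"
      using torus_fibers_separated[of "fst pq" "snd pq"] by metis
    show "\<forall>\<^sub>F \<delta> in at_right 0. ?P \<delta> pq"
    proof (rule eventually_at_rightI)
      show "?P d pq" if "d \<in> {0<..<\<delta>}" for d
        using \<delta>(2) that by (meson greaterThanLessThan_iff less_imp_le order.trans)
    qed (rule \<delta>(1))
  qed
  then have "\<forall>\<^sub>F \<delta> in at_right 0. \<forall>pq\<in>Z \<times> Z. ?P \<delta> pq"
    using assms by (intro eventually_ball_finite) auto
  then have "\<forall>\<^sub>F \<delta> in at_right (0::real). 0 < \<delta> \<and> (\<forall>pq\<in>Z \<times> Z. ?P \<delta> pq)"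
    by (intro eventually_conj eventually_at_right_less)
  then obtain \<delta> where \<delta>: "0 < \<delta>" "\<forall>pq\<in>Z \<times> Z. ?P \<delta> pq"
    using eventually_happens'[OF trivial_limit_at_right_real] by blast
  then show ?thesis
    by (intro that[of \<delta>]) (fastforce dest: bspec)+
qed

section \<open>Lifts, weak derivatives and gradients on the torus\<close>

text \<open>Each coordinate of the difference is continuous with values in the multiples of 2 pi,
  hence constant.\<close>

lemma continuous_lift_unique:
  fixes \<phi> \<psi> :: "real \<Rightarrow> real ^ 'n"
  assumes "continuous_on {0..} \<phi>" and "continuous_on {0..} \<psi>"
    and eq: "\<And>t. 0 \<le> t \<Longrightarrow> torus_proj (\<phi> t) = torus_proj (\<psi> t)"
  obtains c where "\<And>t. 0 \<le> t \<Longrightarrow> \<phi> t = \<psi> t + c"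
proof -
  have "(\<lambda>t. \<phi> t $ i - \<psi> t $ i) constant_on {0..}" for i
  proof (rule continuous_discrete_range_constant)
    show "continuous_on {0..} (\<lambda>t. \<phi> t $ i - \<psi> t $ i)"
      by (intro continuous_intros assms)
    fix t :: real assume "t \<in> {0..}"
    have "2 * pi \<le> norm (\<phi> s $ i - \<psi> s $ i - (\<phi> t $ i - \<psi> t $ i))"
      if s: "s \<in> {0..}" "\<phi> s $ i - \<psi> s $ i \<noteq> \<phi> t $ i - \<psi> t $ i" for s
    proof -
      obtain k l :: int where kl: "\<phi> s $ i - \<psi> s $ i = 2 * pi * of_int k"
        "\<phi> t $ i - \<psi> t $ i = 2 * pi * of_int l"
        using eq[of s] eq[of t] s(1) \<open>t \<in> {0..}\<close> unfolding torus_proj_eq_iff by (metis atLeast_iff)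
      with s have "k \<noteq> l" by auto
      then have "1 \<le> \<bar>real_of_int (k - l)\<bar>" by linarith
      moreover have "\<phi> s $ i - \<psi> s $ i - (\<phi> t $ i - \<psi> t $ i) = 2 * pi * of_int (k - l)"
        using kl by (simp add: right_diff_distrib)
      ultimately show ?thesis
        by (simp only: real_norm_def abs_mult) simp
    qed
    then show "\<exists>e>0. \<forall>s. s \<in> {0..} \<and> \<phi> s $ i - \<psi> s $ i \<noteq> \<phi> t $ i - \<psi> t $ i \<longrightarrow>
        e \<le> norm (\<phi> s $ i - \<psi> s $ i - (\<phi> t $ i - \<psi> t $ i))"
      by (intro exI[of _ "2 * pi"]) auto
  qed auto
  then have "\<exists>c. \<forall>t\<in>{0..}. \<phi> t $ i - \<psi> t $ i = c" for i
    unfolding constant_on_def .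
  then obtain c where "\<And>i t. 0 \<le> t \<Longrightarrow> \<phi> t $ i - \<psi> t $ i = c i"
    by (metis atLeast_iff)
  then have "\<phi> t = \<psi> t + (\<chi> i. c i)" if "0 \<le> t" for t
    using that by (simp add: vec_eq_iff algebra_simps)
  then show ?thesis by (rule that)
qed

text \<open>Makes the action independent of the chosen representative: two lifts differ by a
  constant, which has derivative 0.\<close>

lemma torus_weak_derivative_AE_unique:
  assumes "has_torus_weak_derivative \<Phi> v" and "has_torus_weak_derivative \<Phi> w"
  shows "AE t in lebesgue. 0 < t \<longrightarrow> v t = w t"
proof -
  obtain \<phi> where \<phi>: "continuous_on {0..} \<phi>" "\<And>t. t \<ge> 0 \<Longrightarrow> \<Phi> t = torus_proj (\<phi> t)"
    "has_weak_derivative_on \<phi> v {0<..}"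
    using assms(1) unfolding has_torus_weak_derivative_def by blast
  obtain \<psi> where \<psi>: "continuous_on {0..} \<psi>" "\<And>t. t \<ge> 0 \<Longrightarrow> \<Phi> t = torus_proj (\<psi> t)"
    "has_weak_derivative_on \<psi> w {0<..}"
    using assms(2) unfolding has_torus_weak_derivative_def by blast
  obtain c where c: "\<And>t. 0 \<le> t \<Longrightarrow> \<phi> t = \<psi> t + c"
    using continuous_lift_unique[OF \<phi>(1) \<psi>(1)] \<phi>(2) \<psi>(2) by metis
  have "has_weak_derivative_on (\<lambda>t. \<psi> t + 1 *\<^sub>R c) (\<lambda>t. w t + 1 *\<^sub>R 0) {0<..}"
    by (intro has_weak_derivative_on_add_scaleR \<psi>(3) C1_has_weak_derivative_on) auto
  then have "has_weak_derivative_on \<phi> w {0<..}"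
    using c by (auto intro: has_weak_derivative_on_cong)
  then show ?thesis
    by (rule weak_derivative_AE_unique[OF \<phi>(3)])
qed

lemma has_torus_weak_derivative_torus_weak_derivative:
  "has_torus_weak_derivative \<Phi> v \<Longrightarrow> has_torus_weak_derivative \<Phi> (torus_weak_derivative \<Phi>)"
  unfolding torus_weak_derivative_def by (rule someI[where P = "has_torus_weak_derivative \<Phi>"])

text \<open>Translation by x - y is a period of the lifted function, so it carries the gradient at x
  to the gradient at y.\<close>

lemma GDERIV_torus_invariant:
  assumes g: "\<And>x. GDERIV (Q \<circ> torus_proj) x :> g x" and "torus_proj x = torus_proj y"
  shows "g x = g y"
proof -
  have "((\<lambda>z. z + (x - y)) has_derivative (\<lambda>h. h)) (at y)"
    by (auto intro!: derivative_eq_intros)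
  moreover have "((Q \<circ> torus_proj) has_derivative (\<lambda>h. inner h (g x))) (at (y + (x - y)))"
    using g[of x] by (simp add: gderiv_def)
  ultimately have "((\<lambda>z. (Q \<circ> torus_proj) (z + (x - y))) has_derivative (\<lambda>h. inner h (g x))) (at y)"
    by (rule has_derivative_compose)
  moreover have "torus_proj (z + (x - y)) = torus_proj z" for z
    using assms(2) by (simp add: torus_proj_eq_iff)
  ultimately have "GDERIV (Q \<circ> torus_proj) y :> g x"
    by (simp add: gderiv_def comp_def)
  then show ?thesis
    using g GDERIV_unique by blast
qed

lemma torus_gradient_eq:
  assumes "\<And>x. GDERIV (Q \<circ> torus_proj) x :> g x"
  shows "torus_gradient Q (torus_proj x) = g x"
  unfolding torus_gradient_def
proof (rule the_equality)
  show "\<forall>y. torus_proj y = torus_proj x \<longrightarrow> GDERIV (Q \<circ> torus_proj) y :> g x"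
    using assms GDERIV_torus_invariant[OF assms] by metis
  show "g' = g x" if "\<forall>y. torus_proj y = torus_proj x \<longrightarrow> GDERIV (Q \<circ> torus_proj) y :> g'" for g'
    using that assms GDERIV_unique by blast
qed

section \<open>Convergence to a single zero of the potential\<close>

lemma lift_tendsto_zero:
  fixes Q :: "circle ^ 'n \<Rightarrow> real" and \<phi> :: "real \<Rightarrow> real ^ 'n"
  defines "f \<equiv> Q \<circ> torus_proj"
  assumes nonneg: "\<And>p. 0 \<le> Q p" and "finite {p. Q p = 0}"
    and f: "continuous_on UNIV f" and \<phi>: "continuous_on {0..} \<phi>"
    and lim: "((\<lambda>t. f (\<phi> t)) \<longlongrightarrow> 0) at_top"
  obtains z where "f z = 0" and "(\<phi> \<longlongrightarrow> z) at_top"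
proof -
  have near_zero: "\<exists>\<epsilon>>0. \<forall>x. f x < \<epsilon> \<longrightarrow> (\<exists>z. f z = 0 \<and> dist x z < d)" if "0 < d" for d
  proof -
    \<comment> \<open>The points of the cube at distance at least d from all zeros, including the
      zeros outside the cube. Unless this compact set is empty, f has a positive minimum on
      it.\<close>
    define K where "K = cbox 0 (\<chi> i::'n. 2 * pi) - (\<Union>z\<in>{z. f z = 0}. ball z d)"
    have "compact K"
      unfolding K_def by (intro compact_diff compact_cbox open_UN) auto
    have "\<exists>\<epsilon>>0. \<forall>x\<in>K. \<epsilon> \<le> f x"
    proof (cases "K = {}")
      case True
      then show ?thesis by (intro exI[of _ 1]) auto
    next
      case False
      obtain m where m: "m \<in> K" "\<And>x. x \<in> K \<Longrightarrow> f m \<le> f x"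
        using continuous_attains_inf[OF \<open>compact K\<close> False continuous_on_subset[OF f]] by auto
      then have "f m \<noteq> 0"
        using \<open>0 < d\<close> by (auto simp: K_def)
      then have "0 < f m"
        using nonneg by (simp add: f_def order_less_le)
      with m(2) show ?thesis by blast
    qed
    then obtain \<epsilon> where \<epsilon>: "0 < \<epsilon>" "\<And>x. x \<in> K \<Longrightarrow> \<epsilon> \<le> f x" by blast
    have "\<exists>z. f z = 0 \<and> dist x z < d" if "f x < \<epsilon>" for x
    proof -
      obtain y where y: "torus_proj y = torus_proj x" "y \<in> cbox 0 (\<chi> i. 2 * pi)"
        by (rule torus_proj_surj_box)
      then have "f y < \<epsilon>" using that by (simp add: f_def)
      then have "y \<notin> K" using \<epsilon>(2) by (auto simp: not_le[symmetric])
      then obtain z where z: "f z = 0" "dist z y < d"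
        using y(2) by (auto simp: K_def)
      \<comment> \<open>The zero near y is moved next to x by the period x - y.\<close>
      have "torus_proj (x + (z - y)) = torus_proj (y + (z - y))"
        using y(1) by (intro torus_proj_translate) simp
      then have "f (x + (z - y)) = 0"
        using z(1) by (simp add: f_def)
      moreover have "dist x (x + (z - y)) = dist z y"
        by (simp add: dist_norm norm_minus_commute)
      ultimately show ?thesis
        using z(2) by metis
    qed
    with \<epsilon>(1) show ?thesis by blast
  qed
  obtain \<delta> where "0 < \<delta>"
    and sep: "\<And>x y. f x = 0 \<Longrightarrow> f y = 0 \<Longrightarrow> x \<noteq> y \<Longrightarrow> \<delta> \<le> dist x y"
    using torus_finite_fibers_separated[OF \<open>finite {p. Q p = 0}\<close>] by (auto simp: f_def)
  have near: "\<exists>T\<ge>0. \<forall>t\<ge>T. \<exists>z. f z = 0 \<and> dist (\<phi> t) z < d" if d: "0 < d" for d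
  proof -
    obtain \<epsilon> where \<epsilon>: "0 < \<epsilon>" "\<And>x. f x < \<epsilon> \<Longrightarrow> \<exists>z. f z = 0 \<and> dist x z < d"
      using near_zero[OF d] by blast
    have "\<forall>\<^sub>F t in at_top. f (\<phi> t) < \<epsilon>"
      using order_tendstoD(2)[OF lim \<epsilon>(1)] .
    then obtain T where "\<And>t. T \<le> t \<Longrightarrow> f (\<phi> t) < \<epsilon>"
      unfolding eventually_at_top_linorder by blast
    then show ?thesis
      using \<epsilon>(2) by (intro exI[of _ "max 0 T"]) auto
  qed
  \<comment> \<open>Radius \<delta> / 3 makes balls around different zeros disjoint.\<close>
  obtain T where T: "0 \<le> T" "\<And>t. T \<le> t \<Longrightarrow> \<exists>z. f z = 0 \<and> dist (\<phi> t) z < \<delta> / 3"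
    using near[of "\<delta> / 3"] \<open>0 < \<delta>\<close> by auto
  obtain z where z: "f z = 0" "dist (\<phi> T) z < \<delta> / 3"
    using T(2) by blast
  have close: "dist (\<phi> t) z < \<delta> / 3" if "T \<le> t" for t
  proof -
    let ?A = "ball z (\<delta> / 3)" and ?B = "\<Union>w\<in>{w. f w = 0 \<and> w \<noteq> z}. ball w (\<delta> / 3)"
    have "connected (\<phi> ` {T..})"
      using T(1) by (intro connected_continuous_image continuous_on_subset[OF \<phi>]) auto
    moreover have "?A \<inter> ?B \<inter> \<phi> ` {T..} = {}"
    proof -
      have "False" if "dist z u < \<delta> / 3" "f w = 0" "w \<noteq> z" "dist w u < \<delta> / 3" for u w
        using sep[OF z(1) that(2)] that \<open>0 < \<delta>\<close> dist_triangle[of z w u] by (auto simp: dist_commute)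
      then show ?thesis by auto
    qed
    moreover have "\<phi> ` {T..} \<subseteq> ?A \<union> ?B"
      using T(2) by (fastforce simp: dist_commute)
    ultimately have "?A \<inter> \<phi> ` {T..} = {} \<or> ?B \<inter> \<phi> ` {T..} = {}"
      by (intro connectedD) auto
    moreover have "\<phi> T \<in> ?A \<inter> \<phi> ` {T..}"
      using z(2) by (simp add: dist_commute)
    ultimately have "?B \<inter> \<phi> ` {T..} = {}" by blast
    then have "\<phi> t \<in> ?A"
      using \<open>\<phi> ` {T..} \<subseteq> ?A \<union> ?B\<close> that by blast
    then show ?thesis by (simp add: dist_commute)
  qed
  have "(\<phi> \<longlongrightarrow> z) at_top"
  proof (rule tendstoI)
    fix e :: real assume "0 < e"
    \<comment> \<open>A zero found at this finer scale lies within 2 \<delta> / 3 of z, so the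
      separation forces it to be z.\<close>
    then obtain S where S: "\<And>t. S \<le> t \<Longrightarrow> \<exists>w. f w = 0 \<and> dist (\<phi> t) w < min e (\<delta> / 3)"
      using near[of "min e (\<delta> / 3)"] \<open>0 < \<delta>\<close> by auto
    have "dist (\<phi> t) z < e" if t: "max S T \<le> t" for t
    proof -
      obtain w where w: "f w = 0" "dist (\<phi> t) w < min e (\<delta> / 3)"
        using S t by auto
      have "dist z w < \<delta>"
        using w(2) close[of t] t dist_triangle2[of z w "\<phi> t"] \<open>0 < \<delta>\<close> by (auto simp: dist_commute)
      then have "w = z"
        using sep[OF z(1) w(1)] by fastforce
      with w show ?thesis by simp
    qed
    then show "\<forall>\<^sub>F t in at_top. dist (\<phi> t) z < e"
      unfolding eventually_at_top_linorder by blast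
  qed
  with z(1) show ?thesis by (rule that)
qed

section \<open>Decay along conservative trajectories\<close>

text \<open>A form of Barbalat's lemma: a late value of at least e keeps g above e / 2 for a time d
  that does not depend on t, which contradicts the convergence of the integral.\<close>

lemma integrable_lipschitz_tendsto_0:
  fixes g :: "real \<Rightarrow> real"
  assumes nonneg: "\<And>t. 0 < t \<Longrightarrow> 0 \<le> g t" and int: "set_integrable lebesgue {0<..} g"
    and lip: "\<And>s t. 0 < s \<Longrightarrow> 0 < t \<Longrightarrow> \<bar>g s - g t\<bar> \<le> L * \<bar>s - t\<bar>"
  shows "(g \<longlongrightarrow> 0) at_top"
proof (rule tendstoI)
  fix e :: real assume "0 < e"
  \<comment> \<open>L need not be positive, and d divides by M.\<close>
  define M where "M = max L 1"
  have M: "0 < M" "\<bar>g s - g t\<bar> \<le> M * \<bar>s - t\<bar>" if "0 < s" "0 < t" for s t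
    using lip[OF that] mult_right_mono[of L M "\<bar>s - t\<bar>"] by (auto simp: M_def)
  have "0 < M" by (simp add: M_def)
  \<comment> \<open>With Lipschitz constant M, falling from e to e / 2 takes at least this
    long.\<close>
  define d where "d = e / (2 * M)"
  have "0 < d" using \<open>0 < e\<close> \<open>0 < M\<close> by (simp add: d_def)
  \<comment> \<open>Starting at 1 keeps closed intervals inside the open half-line.\<close>
  have int1: "set_integrable lebesgue {1..} g"
    by (rule set_integrable_subset[OF int]) auto
  have "((\<lambda>b. LINT t:{1..b}|lebesgue. g t) \<longlongrightarrow> (LINT t:{1..}|lebesgue. g t)) at_top"
    by (rule tendsto_set_lebesgue_integral_at_top[OF _ int1]) auto
  \<comment> \<open>Two such errors sum to less than e d / 2, the least integral of g over the time
    d after a value of at least e.\<close>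
  then have "\<forall>\<^sub>F b in at_top. dist (LINT t:{1..b}|lebesgue. g t) (LINT t:{1..}|lebesgue. g t) < e * d / 4"
    using \<open>0 < e\<close> \<open>0 < d\<close> by (intro tendstoD) auto
  then obtain T where T: "\<And>b. T \<le> b \<Longrightarrow>
      dist (LINT t:{1..b}|lebesgue. g t) (LINT t:{1..}|lebesgue. g t) < e * d / 4"
    unfolding eventually_at_top_linorder by blast
  have int_icc: "g absolutely_integrable_on {s..t}" if "1 \<le> s" for s t
    by (rule set_integrable_subset[OF int]) (use that in auto)
  have small: "dist (g t) 0 < e" if t: "max T 1 \<le> t" for t
  proof (rule ccontr)
    assume "\<not> ?thesis"
    then have "e \<le> g t" using nonneg[of t] t by auto
    have "e / 2 \<le> g s" if "s \<in> {t..t + d}" for s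
    proof -
      have "g t - g s \<le> M * \<bar>t - s\<bar>"
        using M(2)[of t s] that t by auto
      also have "\<dots> \<le> M * d"
        using that \<open>0 < M\<close> by (intro mult_left_mono) auto
      also have "\<dots> = e / 2"
        using \<open>0 < M\<close> by (simp add: d_def)
      finally show ?thesis using \<open>e \<le> g t\<close> by simp
    qed
    then have "integral {t..t + d} (\<lambda>_. e / 2) \<le> integral {t..t + d} g"
      using t by (intro integral_le set_lebesgue_integral_eq_integral(1)[OF int_icc]) auto
    then have 1: "e * d / 2 \<le> integral {t..t + d} g"
      using \<open>0 < d\<close> by (simp add: mult.commute)
    have 2: "integral {1..t} g + integral {t..t + d} g = integral {1..t + d} g"
      using t \<open>0 < d\<close> by (intro Henstock_Kurzweil_Integration.integral_combine
          set_lebesgue_integral_eq_integral(1)[OF int_icc]) auto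
    have 3: "(LINT t:{1..b}|lebesgue. g t) = integral {1..b} g" for b
      by (rule set_lebesgue_integral_eq_integral(2)[OF int_icc]) simp
    have "0 < e * d" using \<open>0 < e\<close> \<open>0 < d\<close> by simp
    moreover have "T \<le> t" "T \<le> t + d" using t \<open>0 < d\<close> by auto
    ultimately show False
      using 1 2 T[of t] T[of "t + d"] unfolding 3 dist_real_def by linarith
  qed
  then show "\<forall>\<^sub>F t in at_top. dist (g t) 0 < e"
    unfolding eventually_at_top_linorder by blast
qed

text \<open>Conservation of energy makes the Lagrangian equal to \<open>E + 2 f(\<phi>)\<close>, which is Lipschitz because
  \<open>f\<close>, its gradient and hence the velocity are bounded.\<close>

lemma conservative_flow_tendsto_0:
  fixes \<phi> V :: "real \<Rightarrow> 'a::euclidean_space"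
  assumes f: "\<And>x. GDERIV f x :> g x" and nonneg: "\<And>x. 0 \<le> f x"
    and bounds: "\<And>x. f x \<le> B" "\<And>x. norm (g x) \<le> M"
    and \<phi>: "\<And>t. 0 < t \<Longrightarrow> (\<phi> has_vector_derivative V t) (at t)"
    and V: "\<And>t. 0 < t \<Longrightarrow> (V has_vector_derivative g (\<phi> t)) (at t)"
    and int: "set_integrable lebesgue {0<..} (\<lambda>t. 1/2 * (norm (V t))\<^sup>2 + f (\<phi> t))"
  shows "(V \<longlongrightarrow> 0) at_top" and "((\<lambda>t. f (\<phi> t)) \<longlongrightarrow> 0) at_top"
proof -
  have f\<phi>: "((\<lambda>t. f (\<phi> t)) has_real_derivative inner (V t) (g (\<phi> t))) (at t)" if "0 < t" for t
    using has_derivative_compose[OF \<phi>[OF that, unfolded has_vector_derivative_def]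
        f[of "\<phi> t", unfolded gderiv_def]]
    by (simp add: has_field_derivative_def mult_commute_abs)
  \<comment> \<open>The equation reads V' = + grad f, so the potential energy is - f and the
    difference is conserved.\<close>
  have "\<exists>c. \<forall>t\<in>{0<..}. 1/2 * inner (V t) (V t) - f (\<phi> t) = c"
  proof (rule has_field_derivative_zero_constant)
    fix t :: real assume t: "t \<in> {0<..}"
    have "((\<lambda>t. inner (V t) (V t)) has_vector_derivative
        (inner (V t) (g (\<phi> t)) + inner (g (\<phi> t)) (V t))) (at t)"
      using t by (intro bounded_bilinear.has_vector_derivative[OF bounded_bilinear_inner] V) auto
    then have "((\<lambda>t. inner (V t) (V t)) has_real_derivative 2 * inner (V t) (g (\<phi> t))) (at t)"
      by (simp add: has_real_derivative_iff_has_vector_derivative inner_commute)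
    then have "((\<lambda>t. 1/2 * inner (V t) (V t) - f (\<phi> t)) has_real_derivative
        1/2 * (2 * inner (V t) (g (\<phi> t))) - inner (V t) (g (\<phi> t))) (at t)"
      using t by (intro DERIV_diff DERIV_cmult f\<phi>) auto
    then show "((\<lambda>t. 1/2 * inner (V t) (V t) - f (\<phi> t)) has_real_derivative 0) (at t within {0<..})"
      by (simp add: has_field_derivative_at_within)
  qed (rule convex_real_interval)
  then obtain E where "\<And>t. 0 < t \<Longrightarrow> 1/2 * inner (V t) (V t) - f (\<phi> t) = E"
    by auto
  then have E: "1/2 * (norm (V t))\<^sup>2 = E + f (\<phi> t)" if "0 < t" for t
    using that by (fastforce simp: power2_norm_eq_inner)
  \<comment> \<open>Energy bounds the speed: the squared norm of V t is 2 (E + f(\<phi> t)), at most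
    2 (E + B).\<close>
  define W where "W = sqrt (2 * (E + B))"
  have W: "norm (V t) \<le> W" if "0 < t" for t
    unfolding W_def using E[OF that] bounds(1)[of "\<phi> t"] by (intro real_le_rsqrt) simp
  have M: "0 \<le> M"
    using bounds(2) norm_ge_zero order.trans by blast
  have "\<bar>inner (V t) (g (\<phi> t))\<bar> \<le> W * M" if "0 < t" for t
    using W[OF that] bounds(2)[of "\<phi> t"]
    by (intro order.trans[OF Cauchy_Schwarz_ineq2] mult_mono order.trans[OF norm_ge_zero]) auto
  then have lip: "norm (f (\<phi> s) - f (\<phi> t)) \<le> (W * M) * norm (s - t)" if "0 < s" "0 < t" for s t
    using f\<phi> that
    by (intro field_differentiable_bound[where S = "{0<..}"])
      (auto intro: has_field_derivative_at_within)
  have lim: "((\<lambda>t. 1/2 * (norm (V t))\<^sup>2 + f (\<phi> t)) \<longlongrightarrow> 0) at_top"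
  proof (rule integrable_lipschitz_tendsto_0[OF _ int])
    show "0 \<le> 1/2 * (norm (V t))\<^sup>2 + f (\<phi> t)" for t
      using nonneg by simp
    show "\<bar>1/2 * (norm (V s))\<^sup>2 + f (\<phi> s) - (1/2 * (norm (V t))\<^sup>2 + f (\<phi> t))\<bar> \<le> (2 * W * M) * \<bar>s - t\<bar>"
      if "0 < s" "0 < t" for s t
    proof -
      have "\<bar>E + f (\<phi> s) + f (\<phi> s) - (E + f (\<phi> t) + f (\<phi> t))\<bar> = 2 * \<bar>f (\<phi> s) - f (\<phi> t)\<bar>"
        by (simp add: abs_if)
      also have "\<dots> \<le> (2 * W * M) * \<bar>s - t\<bar>"
        using lip[OF that] by simp
      finally show ?thesis
        unfolding E[OF that(1)] E[OF that(2)] .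
    qed
  qed
  show "((\<lambda>t. f (\<phi> t)) \<longlongrightarrow> 0) at_top"
    by (rule tendsto_sandwich[OF _ _ tendsto_const lim]) (auto intro!: always_eventually nonneg)
  have "((\<lambda>t. 1/2 * (norm (V t))\<^sup>2) \<longlongrightarrow> 0) at_top"
    by (rule tendsto_sandwich[OF _ _ tendsto_const lim]) (auto intro!: always_eventually nonneg)
  from tendsto_real_sqrt[OF tendsto_mult[OF tendsto_const[of 2] this]]
  have "((\<lambda>t. norm (V t)) \<longlongrightarrow> 0) at_top"
    by simp
  then show "(V \<longlongrightarrow> 0) at_top"
    by (rule tendsto_norm_zero_cancel)
qed

section \<open>First variation of the action\<close>

text \<open>The identity is exact, with no smallness of \<eta> or e. Each correction is integrable
  on its own, since \<eta> and its derivative have compact support, v is locally integrable and f is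
  continuous; hence the integral may be split.\<close>

lemma action_variation:
  fixes Q :: "circle ^ 'n \<Rightarrow> real" and e :: "real ^ 'n"
  defines "f \<equiv> Q \<circ> torus_proj"
  assumes \<Phi>: "\<Phi> \<in> admissible Q \<Phi>\<^sub>0" and f: "continuous_on UNIV f"
    and \<phi>: "continuous_on {0..} \<phi>" "\<And>t. 0 \<le> t \<Longrightarrow> \<Phi> t = torus_proj (\<phi> t)"
    and v: "has_weak_derivative_on \<phi> v {0<..}" "v = torus_weak_derivative \<Phi>"
    and \<eta>: "test_function_on {0<..} \<eta>"
  defines "\<Psi> \<equiv> \<lambda>t. torus_proj (\<phi> t + \<eta> t *\<^sub>R e)"
  shows "\<Psi> \<in> admissible Q \<Phi>\<^sub>0"
    and "action Q \<Psi> = action Q \<Phi> + ((LINT t:{0<..}|lebesgue. deriv \<eta> t * inner (v t) e)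
      + 1/2 * (norm e)\<^sup>2 * (LINT t:{0<..}|lebesgue. (deriv \<eta> t)\<^sup>2)
      + (LINT t:{0<..}|lebesgue. f (\<phi> t + \<eta> t *\<^sub>R e) - f (\<phi> t)))"
proof -
  obtain a b where ab: "0 < a" "a < b"
    "\<And>t. t \<notin> {a<..<b} \<Longrightarrow> \<eta> t = 0" "\<And>t. t \<notin> {a<..<b} \<Longrightarrow> deriv \<eta> t = 0"
    "\<And>t. (\<eta> has_real_derivative deriv \<eta> t) (at t)"
    "continuous_on UNIV \<eta>" "continuous_on UNIV (deriv \<eta>)"
    by (rule test_function_on_halflineE[OF \<eta>]) blast
  note cont = continuous_on_subset[OF ab(6) subset_UNIV] continuous_on_subset[OF ab(7) subset_UNIV]
  have v_loc: "locally_integrable_on v {0<..}"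
    using v(1) unfolding has_weak_derivative_on_def by blast
  define w where "w = (\<lambda>t. v t + deriv \<eta> t *\<^sub>R e)"
  have "has_weak_derivative_on (\<lambda>t. \<phi> t + 1 *\<^sub>R (\<eta> t *\<^sub>R e)) (\<lambda>t. v t + 1 *\<^sub>R (deriv \<eta> t *\<^sub>R e)) {0<..}"
  proof (intro has_weak_derivative_on_add_scaleR v(1) C1_has_weak_derivative_on)
    show "((\<lambda>t. \<eta> t *\<^sub>R e) has_vector_derivative deriv \<eta> t *\<^sub>R e) (at t)" for t
      using has_vector_derivative_scaleR[OF ab(5) has_vector_derivative_const[of e]] by simp
  qed (intro continuous_intros cont)
  then have \<Psi>_w: "has_torus_weak_derivative \<Psi> w"
    unfolding has_torus_weak_derivative_def \<Psi>_def w_def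
    by (intro exI[of _ "\<lambda>t. \<phi> t + \<eta> t *\<^sub>R e"] conjI continuous_intros cont \<phi>(1)) auto
  note \<Psi>_w' = has_torus_weak_derivative_torus_weak_derivative[OF \<Psi>_w]
  \<comment> \<open>The explicit weak derivative w is not the representative that enters the action
    of the varied curve; they agree only almost everywhere.\<close>
  have ae: "AE t in lebesgue. 0 < t \<longrightarrow> w t = torus_weak_derivative \<Psi> t"
    by (rule torus_weak_derivative_AE_unique[OF \<Psi>_w \<Psi>_w'])
  define P1 where "P1 = (\<lambda>t. deriv \<eta> t * inner (v t) e)"
  define P2 where "P2 = (\<lambda>t. (deriv \<eta> t)\<^sup>2)"
  define P3 where "P3 = (\<lambda>t. f (\<phi> t + \<eta> t *\<^sub>R e) - f (\<phi> t))"
  have P1: "set_integrable lebesgue {0<..} P1"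
  proof -
    have "integrable lebesgue (\<lambda>t. inner (indicator {0<..} t *\<^sub>R (deriv \<eta> t *\<^sub>R v t)) e)"
      using set_integrable_test_function(2)[OF v_loc \<eta>] unfolding set_integrable_def
      by (rule integrable_inner_left)
    then show ?thesis
      by (simp add: set_integrable_def P1_def mult.assoc)
  qed
  have P2: "set_integrable lebesgue {0<..} P2"
    using ab(1,4) unfolding P2_def
    by (intro set_integral_halfline_compact_support(1)[of a b] continuous_intros cont) auto
  have P3: "set_integrable lebesgue {0<..} P3"
    using ab(1,3) unfolding P3_def
    by (intro set_integral_halfline_compact_support(1)[of a b] continuous_intros cont
        continuous_on_compose2[OF f] continuous_on_subset[OF \<phi>(1)]) auto
  have norm_w: "(norm (w t))\<^sup>2 = (norm (v t))\<^sup>2 + 2 * P1 t + (norm e)\<^sup>2 * P2 t" for t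
    unfolding w_def P1_def P2_def power2_norm_eq_inner
    by (simp add: inner_add_left inner_add_right inner_commute power2_eq_square algebra_simps)
  have L: "lagrangian Q \<Phi> t + (P1 t + 1/2 * (norm e)\<^sup>2 * P2 t + P3 t) = 1/2 * (norm (w t))\<^sup>2 + Q (\<Psi> t)"
    if "0 < t" for t
    unfolding norm_w using that \<phi>(2)[of t]
    by (simp add: lagrangian_def v(2) P3_def f_def \<Psi>_def algebra_simps)
  have ae_L: "AE t in lebesgue. t \<in> {0<..} \<longrightarrow>
      lagrangian Q \<Phi> t + (P1 t + 1/2 * (norm e)\<^sup>2 * P2 t + P3 t) = lagrangian Q \<Psi> t"
    using ae
  proof eventually_elim
    case (elim t)
    then show ?case
      using L[of t] by (auto simp: lagrangian_def)
  qed
  have int_\<Phi>: "set_integrable lebesgue {0<..} (lagrangian Q \<Phi>)"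
    using \<Phi> by (simp add: admissible_def)
  have P12: "set_integrable lebesgue {0<..} (\<lambda>t. P1 t + 1/2 * (norm e)\<^sup>2 * P2 t)"
    by (intro set_integral_add(1) P1 set_integrable_mult_right P2)
  have P: "set_integrable lebesgue {0<..} (\<lambda>t. P1 t + 1/2 * (norm e)\<^sup>2 * P2 t + P3 t)"
    by (intro set_integral_add(1) P12 P3)
  have int_L: "set_integrable lebesgue {0<..}
      (\<lambda>t. lagrangian Q \<Phi> t + (P1 t + 1/2 * (norm e)\<^sup>2 * P2 t + P3 t))"
    by (intro set_integral_add(1) int_\<Phi> P)
  have int_\<Psi>: "set_integrable lebesgue {0<..} (lagrangian Q \<Psi>)"
    by (rule set_integral_lebesgue_AE(1)[OF int_L ae_L])
  have "square_integrable_on (torus_weak_derivative \<Psi>) {0<..<T}" if "0 < T" for T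
  proof -
    have v_sq: "set_borel_measurable lebesgue {0<..<T} v"
      "set_integrable lebesgue {0<..<T} (\<lambda>t. (norm (v t))\<^sup>2)"
      using \<Phi> that unfolding v(2) by (auto simp: admissible_def H1_loc_def square_integrable_on_def)
    have ae_T: "AE t in lebesgue. t \<in> {0<..<T} \<longrightarrow> w t = torus_weak_derivative \<Psi> t"
      using ae by eventually_elim auto
    have "(\<lambda>t. deriv \<eta> t *\<^sub>R e) \<in> borel_measurable borel"
      by (intro borel_measurable_continuous_onI continuous_intros cont)
    then have "(\<lambda>t. deriv \<eta> t *\<^sub>R e) \<in> borel_measurable lebesgue"
      by (intro measurable_completion) simp
    then have "(\<lambda>t. indicator {0<..<T} t *\<^sub>R (deriv \<eta> t *\<^sub>R e)) \<in> borel_measurable lebesgue"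
      by (rule borel_measurable_scaleR[OF borel_measurable_indicator, rotated]) simp
    then have "(\<lambda>t. indicator {0<..<T} t *\<^sub>R v t + indicator {0<..<T} t *\<^sub>R (deriv \<eta> t *\<^sub>R e))
        \<in> borel_measurable lebesgue"
      using v_sq(1) unfolding set_borel_measurable_def by (rule borel_measurable_add[rotated])
    then have "set_borel_measurable lebesgue {0<..<T} w"
      unfolding set_borel_measurable_def w_def scaleR_add_right .
    then have "set_borel_measurable lebesgue {0<..<T} (torus_weak_derivative \<Psi>)"
      by (rule set_borel_measurable_lebesgue_AE[OF _ ae_T])
    moreover have "set_integrable lebesgue {0<..<T} (\<lambda>t. (norm (w t))\<^sup>2)"
      unfolding norm_w
      by (intro set_integral_add(1) v_sq(2) set_integrable_mult_right
          set_integrable_subset[OF P1] set_integrable_subset[OF P2]) auto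
    then have "set_integrable lebesgue {0<..<T} (\<lambda>t. (norm (torus_weak_derivative \<Psi> t))\<^sup>2)"
    proof (rule set_integral_lebesgue_AE(1))
      show "AE t in lebesgue. t \<in> {0<..<T} \<longrightarrow> (norm (w t))\<^sup>2 = (norm (torus_weak_derivative \<Psi> t))\<^sup>2"
        using ae_T by eventually_elim auto
    qed
    ultimately show ?thesis
      unfolding square_integrable_on_def by blast
  qed
  moreover have "continuous_on {0..} \<Psi>"
    unfolding \<Psi>_def by (intro continuous_on_torus_proj continuous_intros cont \<phi>(1))
  moreover have "\<Psi> 0 = \<Phi>\<^sub>0"
    using \<Phi> \<phi>(2)[of 0] ab(1) ab(3)[of 0] by (simp add: \<Psi>_def admissible_def)
  ultimately show "\<Psi> \<in> admissible Q \<Phi>\<^sub>0"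
    using int_\<Psi> \<Psi>_w unfolding admissible_def H1_loc_def by blast
  have "action Q \<Psi> = (LINT t:{0<..}|lebesgue. lagrangian Q \<Phi> t + (P1 t + 1/2 * (norm e)\<^sup>2 * P2 t + P3 t))"
    unfolding action_def by (rule set_integral_lebesgue_AE(2)[OF int_L ae_L])
  also have "\<dots> = action Q \<Phi> + ((LINT t:{0<..}|lebesgue. P1 t)
      + (LINT t:{0<..}|lebesgue. 1/2 * (norm e)\<^sup>2 * P2 t) + (LINT t:{0<..}|lebesgue. P3 t))"
    unfolding action_def set_integral_add(2)[OF int_\<Phi> P] set_integral_add(2)[OF P12 P3]
      set_integral_add(2)[OF P1 set_integrable_mult_right[OF P2]] ..
  finally show "action Q \<Psi> = action Q \<Phi> + ((LINT t:{0<..}|lebesgue. deriv \<eta> t * inner (v t) e)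
      + 1/2 * (norm e)\<^sup>2 * (LINT t:{0<..}|lebesgue. (deriv \<eta> t)\<^sup>2)
      + (LINT t:{0<..}|lebesgue. f (\<phi> t + \<eta> t *\<^sub>R e) - f (\<phi> t)))"
    unfolding P1_def P2_def P3_def set_integral_mult_right .
qed

text \<open>A and B abstract the linear and quadratic coefficients of the kinetic term. The
  right-hand side of the assumption vanishes at \<epsilon> = 0, so it has a minimum there and its
  derivative is 0.\<close>

lemma first_variation_eq_0:
  fixes f :: "'a::euclidean_space \<Rightarrow> real"
  assumes f: "\<And>x. GDERIV f x :> g x" and g: "continuous_on UNIV g"
    and \<phi>: "continuous_on {0..} \<phi>" and \<eta>: "test_function_on {0<..} \<eta>"
    and min: "\<And>\<epsilon>. 0 \<le> \<epsilon> * A + \<epsilon>\<^sup>2 * B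
      + (LINT t:{0<..}|lebesgue. f (\<phi> t + \<eta> t *\<^sub>R (\<epsilon> *\<^sub>R e)) - f (\<phi> t))"
  shows "A + (LINT t:{0<..}|lebesgue. \<eta> t * inner (g (\<phi> t)) e) = 0"
proof -
  obtain a b where ab: "0 < a" "a < b"
    "\<And>t. t \<notin> {a<..<b} \<Longrightarrow> \<eta> t = 0" "\<And>t. t \<notin> {a<..<b} \<Longrightarrow> deriv \<eta> t = 0"
    "\<And>t. (\<eta> has_real_derivative deriv \<eta> t) (at t)"
    "continuous_on UNIV \<eta>" "continuous_on UNIV (deriv \<eta>)"
    by (rule test_function_on_halflineE[OF \<eta>]) blast
  have f_cont: "continuous_on UNIV f"
    using f unfolding gderiv_def
    by (intro continuous_at_imp_continuous_on) (auto intro: has_derivative_continuous)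
  have \<eta>_cont: "continuous_on S \<eta>" for S
    using ab(6) continuous_on_subset by blast
  have \<phi>_cont: "continuous_on {a..b} \<phi>"
    using \<phi> by (rule continuous_on_subset) (use ab(1) in auto)
  let ?F = "\<lambda>\<epsilon> t. f (\<phi> t + \<eta> t *\<^sub>R (\<epsilon> *\<^sub>R e)) - f (\<phi> t)"
  let ?F' = "\<lambda>\<epsilon> t. \<eta> t * inner (g (\<phi> t + \<eta> t *\<^sub>R (\<epsilon> *\<^sub>R e))) e"
  have F_cont: "continuous_on {a..b} (?F \<epsilon>)" for \<epsilon>
    by (intro continuous_intros continuous_on_compose2[OF f_cont] \<eta>_cont \<phi>_cont) auto
  have F_int: "(LINT t:{0<..}|lebesgue. ?F \<epsilon> t) = integral {a..b} (?F \<epsilon>)" for \<epsilon>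
    using ab(1,3) F_cont by (intro set_integral_halfline_compact_support(2)) auto
  have F'_int: "(LINT t:{0<..}|lebesgue. ?F' 0 t) = integral {a..b} (?F' 0)"
    using ab(1,3)
    by (intro set_integral_halfline_compact_support(2) continuous_intros
        continuous_on_compose2[OF g] \<eta>_cont \<phi>_cont) auto
  have F_deriv: "((\<lambda>\<epsilon>. ?F \<epsilon> t) has_real_derivative ?F' \<epsilon> t) (at \<epsilon>)" for \<epsilon> t
  proof -
    have "((\<lambda>\<epsilon>. \<phi> t + \<eta> t *\<^sub>R (\<epsilon> *\<^sub>R e)) has_derivative (\<lambda>h. \<eta> t *\<^sub>R (h *\<^sub>R e))) (at \<epsilon>)"
      by (auto intro!: derivative_eq_intros)
    from has_derivative_compose[OF this f[unfolded gderiv_def]]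
    have "((\<lambda>\<epsilon>. f (\<phi> t + \<eta> t *\<^sub>R (\<epsilon> *\<^sub>R e))) has_derivative (\<lambda>h. h * ?F' \<epsilon> t)) (at \<epsilon>)"
      by (simp add: inner_commute mult_ac)
    then have "((\<lambda>\<epsilon>. f (\<phi> t + \<eta> t *\<^sub>R (\<epsilon> *\<^sub>R e))) has_real_derivative ?F' \<epsilon> t) (at \<epsilon>)"
      by (simp only: has_field_derivative_def mult_commute_abs)
    from DERIV_diff[OF this DERIV_const[of "f (\<phi> t)"]] show ?thesis by simp
  qed
  \<comment> \<open>The Leibniz rule applies because the interval is compact and the
    \<epsilon>-derivative of the integrand is jointly continuous.\<close>
  have "((\<lambda>\<epsilon>. integral (cbox a b) (?F \<epsilon>)) has_real_derivative integral (cbox a b) (?F' 0)) (at 0 within UNIV)"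
  proof (rule leibniz_rule_field_derivative)
    show "((\<lambda>\<epsilon>. ?F \<epsilon> t) has_real_derivative ?F' \<epsilon> t) (at \<epsilon> within UNIV)" for \<epsilon> t
      by (rule F_deriv)
    show "?F \<epsilon> integrable_on cbox a b" for \<epsilon>
      using F_cont[of \<epsilon>] by (simp add: integrable_continuous_interval)
    have "continuous_on (UNIV \<times> {a..b}) (\<lambda>p. ?F' (fst p) (snd p))"
      by (intro continuous_intros continuous_on_compose2[OF g] continuous_on_compose2[OF \<eta>_cont[of UNIV]]
          continuous_on_compose2[OF \<phi>_cont]) auto
    then show "continuous_on (UNIV \<times> cbox a b) (\<lambda>(\<epsilon>, t). ?F' \<epsilon> t)"
      by (simp add: case_prod_unfold)
  qed auto
  then have "((\<lambda>\<epsilon>. \<epsilon> * A + \<epsilon>\<^sup>2 * B + integral {a..b} (?F \<epsilon>)) has_real_derivative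
      A + integral {a..b} (?F' 0)) (at 0)"
    by (auto intro!: derivative_eq_intros)
  then have "A + integral {a..b} (?F' 0) = 0"
  proof (rule DERIV_local_min)
    show "\<forall>\<epsilon>. \<bar>0 - \<epsilon>\<bar> < 1 \<longrightarrow> 0 * A + 0\<^sup>2 * B + integral {a..b} (?F 0) \<le> \<epsilon> * A + \<epsilon>\<^sup>2 * B + integral {a..b} (?F \<epsilon>)"
      using min unfolding F_int by simp
  qed simp
  then show ?thesis
    using F'_int by simp
qed

text \<open>The first variation in a fixed direction e is the weak equation paired with e; letting e
  range over all vectors recovers the vector identity.\<close>

lemma minimizer_weak_euler_lagrange:
  fixes Q :: "circle ^ 'n \<Rightarrow> real"
  assumes min: "is_arg_min (action Q) (\<lambda>\<Psi>. \<Psi> \<in> admissible Q \<Phi>\<^sub>0) \<Phi>"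
    and f: "\<And>x. GDERIV (Q \<circ> torus_proj) x :> g x" and g: "continuous_on UNIV g"
    and \<phi>: "continuous_on {0..} \<phi>" "\<And>t. 0 \<le> t \<Longrightarrow> \<Phi> t = torus_proj (\<phi> t)"
    and v: "has_weak_derivative_on \<phi> v {0<..}" "v = torus_weak_derivative \<Phi>"
  shows "has_weak_derivative_on v (\<lambda>t. g (\<phi> t)) {0<..}"
proof -
  have \<Phi>: "\<Phi> \<in> admissible Q \<Phi>\<^sub>0"
    using min by (simp add: is_arg_min_def)
  have f_cont: "continuous_on UNIV (Q \<circ> torus_proj)"
    using f unfolding gderiv_def
    by (intro continuous_at_imp_continuous_on) (auto intro: has_derivative_continuous)
  have v_loc: "locally_integrable_on v {0<..}"
    using v(1) unfolding has_weak_derivative_on_def by blast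
  have "continuous_on {0<..} \<phi>"
    using \<phi>(1) by (rule continuous_on_subset) auto
  then have "continuous_on {0<..} (\<lambda>t. g (\<phi> t))"
    by (rule continuous_on_compose2[OF g]) auto
  then have g_loc: "locally_integrable_on (\<lambda>t. g (\<phi> t)) {0<..}"
    by (rule continuous_imp_locally_integrable_on)
  have "(LINT t:{0<..}|lebesgue. deriv \<eta> t *\<^sub>R v t) = - (LINT t:{0<..}|lebesgue. \<eta> t *\<^sub>R g (\<phi> t))"
    if \<eta>: "test_function_on {0<..} \<eta>" for \<eta>
  proof (rule vector_eq_ldot[THEN iffD1], rule allI)
    fix e :: "real ^ 'n"
    have inner: "inner e (LINT t:{0<..}|lebesgue. k t *\<^sub>R u t) = (LINT t:{0<..}|lebesgue. k t * inner (u t) e)"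
      if "set_integrable lebesgue {0<..} (\<lambda>t. k t *\<^sub>R u t)" for k and u :: "real \<Rightarrow> real ^ 'n"
      using integral_inner_left[of e lebesgue "\<lambda>t. indicator {0<..} t *\<^sub>R (k t *\<^sub>R u t)"] that
      unfolding set_lebesgue_integral_def set_integrable_def by (simp add: inner_commute mult.assoc)
    have "(LINT t:{0<..}|lebesgue. deriv \<eta> t * inner (v t) e)
        + (LINT t:{0<..}|lebesgue. \<eta> t * inner (g (\<phi> t)) e) = 0"
    proof (rule first_variation_eq_0[OF f g \<phi>(1) \<eta>, where
          B = "1/2 * (norm e)\<^sup>2 * (LINT t:{0<..}|lebesgue. (deriv \<eta> t)\<^sup>2)"])
      fix \<epsilon> :: real
      \<comment> \<open>The parameter scales the direction, so a single \<eta> serves for every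
        \<epsilon>.\<close>
      note var = action_variation[OF \<Phi> f_cont \<phi> v \<eta>, of "\<epsilon> *\<^sub>R e"]
      have "action Q \<Phi> \<le> action Q (\<lambda>t. torus_proj (\<phi> t + \<eta> t *\<^sub>R (\<epsilon> *\<^sub>R e)))"
        using min var(1) by (auto simp: is_arg_min_linorder)
      from ord_le_eq_trans[OF this var(2)]
      have "0 \<le> (LINT t:{0<..}|lebesgue. deriv \<eta> t * inner (v t) (\<epsilon> *\<^sub>R e))
          + 1/2 * (norm (\<epsilon> *\<^sub>R e))\<^sup>2 * (LINT t:{0<..}|lebesgue. (deriv \<eta> t)\<^sup>2)
          + (LINT t:{0<..}|lebesgue. (Q \<circ> torus_proj) (\<phi> t + \<eta> t *\<^sub>R (\<epsilon> *\<^sub>R e)) - (Q \<circ> torus_proj) (\<phi> t))"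
        by (simp only: le_add_same_cancel1)
      moreover have "(LINT t:{0<..}|lebesgue. deriv \<eta> t * inner (v t) (\<epsilon> *\<^sub>R e))
          = \<epsilon> * (LINT t:{0<..}|lebesgue. deriv \<eta> t * inner (v t) e)"
        by (simp only: inner_scaleR_right mult.left_commute[of _ \<epsilon>] set_integral_mult_right)
      ultimately show "0 \<le> \<epsilon> * (LINT t:{0<..}|lebesgue. deriv \<eta> t * inner (v t) e)
          + \<epsilon>\<^sup>2 * (1/2 * (norm e)\<^sup>2 * (LINT t:{0<..}|lebesgue. (deriv \<eta> t)\<^sup>2))
          + (LINT t:{0<..}|lebesgue. (Q \<circ> torus_proj) (\<phi> t + \<eta> t *\<^sub>R (\<epsilon> *\<^sub>R e)) - (Q \<circ> torus_proj) (\<phi> t))"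
        by (simp add: power_mult_distrib mult_ac)
    qed
    then show "inner e (LINT t:{0<..}|lebesgue. deriv \<eta> t *\<^sub>R v t)
        = inner e (- (LINT t:{0<..}|lebesgue. \<eta> t *\<^sub>R g (\<phi> t)))"
      unfolding inner_minus_right
        inner[OF set_integrable_test_function(2)[OF v_loc \<eta>]]
        inner[OF set_integrable_test_function(1)[OF g_loc \<eta>]] by linarith
  qed
  then show ?thesis
    unfolding has_weak_derivative_on_def using v_loc g_loc by blast
qed

theorem proposition5:
  fixes Q :: "circle ^ 'n \<Rightarrow> real"
    and \<Phi>\<^sub>0 :: "circle ^ 'n"
    and \<Phi> :: "real \<Rightarrow> circle ^ 'n"
  assumes "\<forall>p. 0 \<le> Q p"
    and "torus_real_analytic Q"
    and "{p. Q p = 0} \<noteq> {}"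
    and "finite {p. Q p = 0}"
    and "is_arg_min (action Q) (\<lambda>\<Psi>. \<Psi> \<in> admissible Q \<Phi>\<^sub>0) \<Phi>"
  shows "\<exists>\<Phi>' :: real \<Rightarrow> real ^ 'n.
    (\<forall>t>0. has_torus_derivative \<Phi> (\<Phi>' t) t) \<and>
    (\<exists>\<Phi>bar. is_arg_min Q (\<lambda>_. True) \<Phi>bar \<and>
       (\<Phi> \<longlongrightarrow> \<Phi>bar) at_top \<and>
       (\<Phi>' \<longlongrightarrow> 0) at_top \<and>
       ((\<lambda>t. \<bar>Q (\<Phi> t)\<bar>) \<longlongrightarrow> 0) at_top) \<and>
    ((\<forall>t>0. (\<Phi>' has_vector_derivative torus_gradient Q (\<Phi> t)) (at t)) \<and>
     \<Phi> 0 = \<Phi>\<^sub>0 \<and>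
     (\<Phi>' \<longlongrightarrow> 0) at_top)"
proof -
  define f where "f = Q \<circ> torus_proj"
  obtain g where g: "continuous_on UNIV g" and f: "\<And>x. GDERIV f x :> g x"
    using real_analytic_C1 assms(2) unfolding torus_real_analytic_def f_def by blast
  note f' = f[unfolded f_def]
  have f_cont: "continuous_on UNIV f"
    using f unfolding gderiv_def
    by (intro continuous_at_imp_continuous_on) (auto intro: has_derivative_continuous)
  have nonneg: "0 \<le> f x" for x
    using assms(1) by (simp add: f_def)
  obtain B where B: "\<And>x. norm (f x) \<le> B"
    using torus_invariant_bounded[OF f_cont] by (auto simp: f_def)
  obtain M where M: "\<And>x. norm (g x) \<le> M"
    using torus_invariant_bounded[OF g] GDERIV_torus_invariant[OF f'] by metis
  have \<Phi>: "\<Phi> \<in> admissible Q \<Phi>\<^sub>0"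
    using assms(5) by (simp add: is_arg_min_def)
  define v where "v = torus_weak_derivative \<Phi>"
  have "has_torus_weak_derivative \<Phi> v"
    using \<Phi> has_torus_weak_derivative_torus_weak_derivative
    unfolding v_def admissible_def H1_loc_def by blast
  then obtain \<phi> where \<phi>: "continuous_on {0..} \<phi>" "\<And>t. 0 \<le> t \<Longrightarrow> \<Phi> t = torus_proj (\<phi> t)"
    and v: "has_weak_derivative_on \<phi> v {0<..}"
    unfolding has_torus_weak_derivative_def by blast
  have \<phi>_cont: "continuous_on {0<..} \<phi>"
    using \<phi>(1) by (rule continuous_on_subset) auto
  have g\<phi>_cont: "continuous_on {0<..} (\<lambda>t. g (\<phi> t))"
    by (rule continuous_on_compose2[OF g \<phi>_cont]) auto
  have "has_weak_derivative_on v (\<lambda>t. g (\<phi> t)) {0<..}"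
    by (rule minimizer_weak_euler_lagrange[OF assms(5) f' g \<phi> v v_def])
  \<comment> \<open>V is the witness for the velocity in the conclusion. It agrees with the chosen
    representative v only almost everywhere, so the integrability of the Lagrangian must still be
    transferred to it.\<close>
  then obtain V where V: "\<And>t. 0 < t \<Longrightarrow> (V has_vector_derivative g (\<phi> t)) (at t)"
    and ae: "AE t in lebesgue. 0 < t \<longrightarrow> v t = V t"
    using weak_derivative_continuous_imp_AE_C1[OF _ g\<phi>_cont] by blast
  have V_cont: "continuous_on {0<..} V"
    using V by (intro continuous_at_imp_continuous_on) (auto intro: has_vector_derivative_continuous)
  have \<phi>': "(\<phi> has_vector_derivative V t) (at t)" if "0 < t" for t
    by (rule weak_derivative_continuous_imp_C1[OF has_weak_derivative_on_AE[OF v V_cont ae] \<phi>_cont V_cont that])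
  have "set_integrable lebesgue {0<..} (lagrangian Q \<Phi>)"
    using \<Phi> by (simp add: admissible_def)
  then have int: "set_integrable lebesgue {0<..} (\<lambda>t. 1/2 * (norm (V t))\<^sup>2 + f (\<phi> t))"
  proof (rule set_integral_lebesgue_AE(1))
    show "AE t in lebesgue. t \<in> {0<..} \<longrightarrow> lagrangian Q \<Phi> t = 1/2 * (norm (V t))\<^sup>2 + f (\<phi> t)"
      using ae by eventually_elim (simp add: lagrangian_def v_def f_def \<phi>(2))
  qed
  have "f x \<le> B" for x
    using B[of x] by simp
  note lims = conservative_flow_tendsto_0[OF f nonneg this M \<phi>' V int]
  obtain z where z: "f z = 0" "(\<phi> \<longlongrightarrow> z) at_top"
    using lift_tendsto_zero[of Q \<phi>] assms(1,4) f_cont \<phi>(1) lims(2) unfolding f_def by blast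
  have proj_lim: "((\<lambda>t. torus_proj (\<phi> t)) \<longlongrightarrow> torus_proj z) at_top"
    using continuous_on_tendsto_compose[OF continuous_on_torus_proj[OF continuous_on_id] z(2), of UNIV] by simp
  have eq: "\<forall>\<^sub>F t in at_top. \<Phi> t = torus_proj (\<phi> t)"
    using eventually_ge_at_top[of 0] by eventually_elim (rule \<phi>(2))
  show ?thesis
  proof (intro exI[of _ V] conjI exI[of _ "torus_proj z"] allI impI)
    show "has_torus_derivative \<Phi> (V t) t" if "0 < t" for t
      unfolding has_torus_derivative_def
    proof (intro exI[of _ \<phi>] conjI \<phi>' that)
      show "\<forall>\<^sub>F s in nhds t. \<Phi> s = torus_proj (\<phi> s)"
        \<comment> \<open>Nothing ties the curve to the lift at negative times; for t > 0 the open
          half-line is a neighbourhood on which they correspond.\<close>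
        unfolding eventually_nhds using that \<phi>(2) by (intro exI[of _ "{0<..}"]) auto
    qed
    show "is_arg_min Q (\<lambda>_. True) (torus_proj z)"
      using z(1) assms(1) by (simp add: is_arg_min_linorder f_def)
    show "(\<Phi> \<longlongrightarrow> torus_proj z) at_top"
      using proj_lim tendsto_cong[OF eq] by simp
    have "\<forall>\<^sub>F t in at_top. \<bar>Q (\<Phi> t)\<bar> = f (\<phi> t)"
      using eq by eventually_elim (use assms(1) in \<open>simp add: f_def\<close>)
    then show "((\<lambda>t. \<bar>Q (\<Phi> t)\<bar>) \<longlongrightarrow> 0) at_top"
      using lims(2) by (simp add: tendsto_cong)
    show "(V has_vector_derivative torus_gradient Q (\<Phi> t)) (at t)" if "0 < t" for t
      using V[OF that] \<phi>(2)[of t] that torus_gradient_eq[OF f'] by simp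
    show "\<Phi> 0 = \<Phi>\<^sub>0"
      using \<Phi> by (simp add: admissible_def)
    show "(V \<longlongrightarrow> 0) at_top" by (rule lims(1))
    show "(V \<longlongrightarrow> 0) at_top" by (rule lims(1))
  qed
qed

end
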